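(* Let $(\omega_n)_{n\in\mathbb{N}}$ be a sequence of positive finite Borel measures on the real line. Suppose that there is a set $X\subset\mathbb{C}_+$ with an accumulation point in $\mathbb{C}_+$ such that for each $z\in X$ the limit $\lim_{n\to\infty}\mathcal{C}[\omega_n](z)$ exists. Then there is a holomorphic function $g:\mathbb{C}_+\to\mathbb{C}_+\cup\mathbb{R}$ such that $$\lim_{n\to\infty}\mathcal{C}[\omega_n](z)=g(z)$$ locally uniformly with respect to $z\in\mathbb{C}_+$. Moreover, for any $z_0=x_0+iy_0$, where $x_0\in\mathbb{R}$ and $y_0>0$, there is a (positive) Borel measure $\tilde\omega_{z_0}$ on the real line such that $$\lim_{n\to\infty}\int_{\mathbb{R}}f(x)\frac{d\omega_n(x)}{|x-z_0|^2}=\int_{\mathbb{R}}f(x)\,d\tilde\omega_{z_0}(x),\qquad f\in\mathcal{C}_0(\mathbb{R}).\qquad( * )$$ Furthermore, the measure $\tilde\omega_{z_0}$ satisfies $\tilde\omega_{z_0}(\mathbb{R})\le\frac1{y_0}\operatorname{Im}(g(z_0))$, and its Cauchy transform is equal to $$\mathcal{C}[\tilde\omega_{z_0}](z)=\frac1{(z-x_0)^2+y_0^2}\Big(g(z)-\operatorname{Re}(g(z_0))-\frac{z-x_0}{y_0}\operatorname{Im}(g(z_0))\Big),\qquad z\in\mathbb{C}_+\setminus\{x_0+iy_0\}.$$ Finally, if $\tilde\omega_{z_0}(\mathbb{R})=\frac1{y_0}\operatorname{Im}(g(z_0))$, then the convergence in $( * )$ holds for every $f\in\mathcal{C}_b(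\mathbb{R})$.
   Context: $\mathbb{C}_+=\{z\in\mathbb{C}:\operatorname{Im}z>0\}$. For a finite Borel measure $\omega$ on $\mathbb{R}$, its Cauchy transform is $\mathcal{C}[\omega](z)=\int_{\mathbb{R}}\frac1{x-z}\,d\omega(x)$, $z\in\mathbb{C}\setminus\mathbb{R}$. $\mathcal{C}_0(\mathbb{R})$ is the space of continuous functions tending to $0$ at $\pm\infty$, and $\mathcal{C}_b(\mathbb{R})$ the space of bounded continuous functions. *)

theory Defs
  imports "HOL-Probability.Probability" "HOL-Complex_Analysis.Complex_Analysis"
begin

definition upper_half_plane :: "complex set" where
  "upper_half_plane = {z. Im z > 0}"

(* Meaningful for a finite Borel measure and non-real z, where the integrand is bounded and
   continuous, hence integrable. *)
definition cauchy_transform :: "real measure \<Rightarrow> complex \<Rightarrow> complex" where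
  "cauchy_transform \<omega> z = (LINT x|\<omega>. 1 / (of_real x - z))"

(* Both function spaces are used with complex values; real-valued test functions are
   covered via the embedding of the reals. *)
definition continuous_vanishing :: "(real \<Rightarrow> 'b::real_normed_vector) set" where
  "continuous_vanishing =
     {f. continuous_on UNIV f \<and> (f \<longlongrightarrow> 0) at_top \<and> (f \<longlongrightarrow> 0) at_bot}"

definition continuous_bounded :: "(real \<Rightarrow> 'b::real_normed_vector) set" where
  "continuous_bounded = {f. continuous_on UNIV f \<and> bounded (range f)}"

definition locally_uniform_limit ::
    "'a::topological_space set \<Rightarrow> ('i \<Rightarrow> 'a \<Rightarrow> 'b::metric_space) \<Rightarrow> ('a \<Rightarrow> 'b) \<Rightarrow> 'i filter \<Rightarrow> bool" where
  "locally_uniform_limit S f l F \<longleftrightarrow>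
     (\<forall>x\<in>S. \<exists>U. open U \<and> x \<in> U \<and> uniform_limit (S \<inter> U) f l F)"

end

theory Submission
  imports Defs
begin

text \<open>
  Every estimate rests on two elementary facts. First, \<open>Im (1 / (x - z)) = Im z / \<bar>x - z\<bar>\<^sup>2\<close>, so the
  imaginary part of the Cauchy transform at \<open>z\<close> is \<open>Im z\<close> times the mass of the weighted measure
  \<open>d\<omega> / \<bar>x - z\<bar>\<^sup>2\<close>. The masses of the \<open>\<omega>\<^sub>n\<close> themselves may tend to infinity; those of the weighted
  measures cannot once the transforms converge at a single point. Second, all the weights
  \<open>1 / \<bar>x - z\<bar>\<^sup>2\<close> are comparable to each other, locally uniformly in \<open>z\<close>. Hence convergence at one point
  makes the transforms locally bounded (\<open>cauchy_transform_bound\<close>), and Vitali's theorem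
  (\<open>Vitali_convergence\<close>) turns convergence on \<open>X\<close> into locally uniform convergence to a holomorphic
  \<open>g\<close>, whose imaginary part is nonnegative as a limit of nonnegative functions.

  Fix \<open>z\<^sub>0\<close> and let \<open>\<mu>\<^sub>n\<close> be \<open>\<omega>\<^sub>n\<close> weighted by \<open>1 / \<bar>x - z\<^sub>0\<bar>\<^sup>2\<close>. The Cayley map
  \<open>v(x) = (x - cnj z\<^sub>0) / (x - z\<^sub>0)\<close> identifies the line together with a point at infinity with the unit
  circle. For \<open>k \<ge> 1\<close> the integrals of \<open>v ^ k\<close> against \<open>\<mu>\<^sub>n\<close> are combinations of the Taylor
  coefficients of the transform of \<open>\<omega>\<^sub>n\<close> at \<open>z\<^sub>0\<close> (\<open>circle_moment_poisson_weighted\<close>), for \<open>k = 0\<close> they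
  are the masses, and for \<open>k < 0\<close> conjugates of the former. All of them converge, because
  derivatives of locally uniformly convergent holomorphic functions converge. By
  Stone--Weierstrass the integrals of every continuous function on the circle then converge
  (\<open>convergent_integral_circle\<close>), in particular those of every continuous function that vanishes at
  infinity. A vaguely convergent subsequence of \<open>\<mu>\<^sub>n\<close>, which exists by Helly's theorem
  (\<open>vague_sequential_compactness\<close>), supplies a measure \<open>\<tau>\<close> representing the limits along
  that subsequence, and these are the limits along the full sequence.

  The bound on the mass of \<open>\<tau>\<close> holds because mass can only be lost at infinity. Its transform is found by
  testing with \<open>1 / (x - z)\<close>, which vanishes at infinity, and expanding
  \<open>1 / ((x - z) \<bar>x - z\<^sub>0\<bar>\<^sup>2)\<close> in partial fractions (\<open>cauchy_transform_poisson_weighted\<close>). If no mass is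
  lost, the parts of the \<open>\<mu>\<^sub>n\<close> near infinity are uniformly small and a cutoff extends the convergence to
  bounded continuous functions (\<open>vague_limit_without_mass_loss\<close>).
\<close>

section \<open>Vitali's theorem on convergence of holomorphic functions\<close>

text \<open>
  By Montel's theorem every subsequence has a locally uniformly convergent subsequence. All limits
  obtained in this way agree on \<open>X\<close>, hence on \<open>S\<close> by the identity theorem, so the full sequence
  converges.
\<close>
theorem Vitali_convergence:
  fixes F :: "nat \<Rightarrow> complex \<Rightarrow> complex"
  assumes S: "open S" "connected S"
    and hol: "\<And>n. F n holomorphic_on S"
    and bdd: "\<And>K. compact K \<Longrightarrow> K \<subseteq> S \<Longrightarrow> \<exists>B. \<forall>n. \<forall>z\<in>K. cmod (F n z) \<le> B"
    and X: "X \<subseteq> S" "p \<in> S" "p islimpt X"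
    and conv: "\<And>z. z \<in> X \<Longrightarrow> convergent (\<lambda>n. F n z)"
  obtains g where "g holomorphic_on S"
    and "\<And>K. compact K \<Longrightarrow> K \<subseteq> S \<Longrightarrow> uniform_limit K F g sequentially"
proof -
  have sub: "\<exists>g r. g holomorphic_on S \<and> strict_mono (r :: nat \<Rightarrow> nat) \<and>
      (\<forall>x\<in>S. (\<lambda>n. F (s (r n)) x) \<longlonglongrightarrow> g x) \<and>
      (\<forall>K. compact K \<and> K \<subseteq> S \<longrightarrow> uniform_limit K (\<lambda>n. F (s (r n))) g sequentially)"
    for s :: "nat \<Rightarrow> nat"
  proof -
    have 1: "\<And>h. h \<in> range F \<Longrightarrow> h holomorphic_on S"
      using hol by auto
    have 2: "\<exists>B. \<forall>h \<in> range F. \<forall>z \<in> K. norm (h z) \<le> B" if "compact K" "K \<subseteq> S" for K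
      using bdd[OF that] by auto
    obtain g r where "g holomorphic_on S" "strict_mono (r :: nat \<Rightarrow> nat)"
      "\<And>x. x \<in> S \<Longrightarrow> (\<lambda>n. F (s (r n)) x) \<longlonglongrightarrow> g x"
      "\<And>K. \<lbrakk>compact K; K \<subseteq> S\<rbrakk> \<Longrightarrow> uniform_limit K ((\<lambda>n. F (s n)) \<circ> r) g sequentially"
      by (rule Montel[OF S(1), of "range F" "\<lambda>n. F (s n)"]) (use 1 2 in auto)
    then show ?thesis
      unfolding o_def by blast
  qed
  obtain g r0 where g: "g holomorphic_on S" and r0: "strict_mono (r0 :: nat \<Rightarrow> nat)"
    and lim0: "\<And>x. x \<in> S \<Longrightarrow> (\<lambda>n. F (r0 n) x) \<longlonglongrightarrow> g x"
    using sub[of "\<lambda>n. n"] by auto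
  have lim_X: "(\<lambda>n. F n z) \<longlonglongrightarrow> g z" if z: "z \<in> X" for z
  proof -
    obtain l where l: "(\<lambda>n. F n z) \<longlonglongrightarrow> l"
      using conv[OF z] by (auto simp: convergent_def)
    from LIMSEQ_subseq_LIMSEQ[OF l r0] have "(\<lambda>n. F (r0 n) z) \<longlonglongrightarrow> l"
      by (simp add: o_def)
    with lim0[of z] X(1) z have "l = g z"
      using LIMSEQ_unique by blast
    with l show ?thesis by simp
  qed
  have unique: "h z = g z"
    if h: "h holomorphic_on S" and s: "strict_mono (s :: nat \<Rightarrow> nat)"
      and lim: "\<And>x. x \<in> S \<Longrightarrow> (\<lambda>n. F (s n) x) \<longlonglongrightarrow> h x" and z: "z \<in> S" for h s z
  proof -
    have "h w - g w = 0" if w: "w \<in> X" for w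
    proof -
      from LIMSEQ_subseq_LIMSEQ[OF lim_X[OF w] s] have "(\<lambda>n. F (s n) w) \<longlonglongrightarrow> g w"
        by (simp add: o_def)
      with lim[of w] X(1) w have "h w = g w"
        using LIMSEQ_unique by blast
      then show ?thesis by simp
    qed
    then have "h z - g z = 0"
      by (intro analytic_continuation[of "\<lambda>z. h z - g z" S X p z] holomorphic_intros h g S X z)
    then show ?thesis by simp
  qed
  have "uniform_limit K F g sequentially" if K: "compact K" "K \<subseteq> S" for K
  proof (rule ccontr)
    assume "\<not> uniform_limit K F g sequentially"
    then obtain e where e: "e > 0"
      and not_ev: "\<not> (\<forall>\<^sub>F n in sequentially. \<forall>x\<in>K. dist (F n x) (g x) < e)"
      by (auto simp: uniform_limit_iff)
    obtain s where s: "strict_mono (s :: nat \<Rightarrow> nat)"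
      and far: "\<And>n. \<not> (\<forall>x\<in>K. dist (F (s n) x) (g x) < e)"
      using not_eventually_sequentiallyD[OF not_ev] by auto
    obtain h r where h: "h holomorphic_on S" and r: "strict_mono (r :: nat \<Rightarrow> nat)"
      and lim: "\<And>x. x \<in> S \<Longrightarrow> (\<lambda>n. F (s (r n)) x) \<longlonglongrightarrow> h x"
      and unif: "uniform_limit K (\<lambda>n. F (s (r n))) h sequentially"
      using sub[of s] K by auto
    have "strict_mono (\<lambda>n. s (r n))"
      using strict_mono_o[OF s r] by (simp add: o_def)
    from unique[OF h this lim] K(2) have "\<And>x. x \<in> K \<Longrightarrow> h x = g x"
      by auto
    with uniform_limitD[OF unif e] have "\<forall>\<^sub>F n in sequentially. \<forall>x\<in>K. dist (F (s (r n)) x) (g x) < e"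
      by (auto elim: eventually_mono)
    then obtain n where "\<forall>x\<in>K. dist (F (s (r n)) x) (g x) < e"
      by (auto simp: eventually_sequentially)
    with far show False by blast
  qed
  with g show ?thesis
    by (rule that)
qed

section \<open>Power series and derivatives of the Cauchy transform\<close>

lemma higher_deriv_power_series:
  fixes a :: "nat \<Rightarrow> complex"
  assumes r: "r > 0" and sums: "\<And>w. w \<in> ball z r \<Longrightarrow> (\<lambda>n. a n * (w - z) ^ n) sums f w"
  shows "(deriv ^^ n) f z = fact n * a n"
proof -
  have "ereal r \<le> conv_radius a"
  proof (rule conv_radius_geI_ex')
    fix t :: real assume t: "0 < t" "ereal t < ereal r"
    then have "z + of_real t \<in> ball z r"
      by (auto simp: dist_norm)
    from sums[OF this] show "summable (\<lambda>n. a n * of_real t ^ n)"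
      by (auto simp: sums_iff)
  qed
  then have rad: "fps_conv_radius (Abs_fps a) > 0"
    using r by (auto simp: fps_conv_radius_def intro: less_le_trans[of _ "ereal r"])
  have "\<forall>\<^sub>F w in nhds 0. w \<in> ball 0 r"
    using r by (intro eventually_nhds_in_open) auto
  then have "\<forall>\<^sub>F w in nhds 0. eval_fps (Abs_fps a) w = (f \<circ> (\<lambda>x. z + x)) w"
  proof eventually_elim
    case (elim w)
    then have "z + w \<in> ball z r"
      by (auto simp: dist_norm)
    from sums[OF this] show ?case
      by (simp add: eval_fps_def sums_iff)
  qed
  with rad have "(f \<circ> (\<lambda>x. z + x)) has_fps_expansion Abs_fps a"
    by (simp add: has_fps_expansion_def)
  from fps_nth_fps_expansion[OF this, of n] show ?thesis
    by (simp add: higher_deriv_shift_0[of n f z])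
qed

lemma abs_Im_le_cmod_diff: "\<bar>Im z\<bar> \<le> cmod (complex_of_real x - z)"
  using abs_Im_le_cmod[of "complex_of_real x - z"] by simp

lemma (in finite_borel_measure) integrable_bounded_continuous:
  fixes f :: "real \<Rightarrow> 'b::{banach, second_countable_topology}"
  assumes "continuous_on UNIV f" and "\<And>x. norm (f x) \<le> B"
  shows "integrable M f"
proof (rule integrable_const_bound)
  show "f \<in> borel_measurable M"
    using borel_measurable_continuous_onI[OF assms(1)] M_is_borel
    by (simp cong: measurable_cong_sets)
qed (use assms in auto)

text \<open>
  Integrate the geometric series of \<open>1 / ((x - z) - (w - z))\<close> in \<open>(w - z) / (x - z)\<close> term by term;
  since \<open>\<bar>x - z\<bar> \<ge> \<bar>Im z\<bar>\<close>, the modulus of its ratio is at most \<open>\<bar>w - z\<bar> / \<bar>Im z\<bar> < 1\<close> for all \<open>x\<close>.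
  Holomorphy and the formula for all derivatives are read off from this expansion.
\<close>
lemma (in finite_borel_measure) cauchy_transform_sums:
  assumes w: "cmod (w - z) < \<bar>Im z\<bar>"
  shows "(\<lambda>j. (LINT x|M. 1 / (of_real x - z) ^ Suc j) * (w - z) ^ j) sums cauchy_transform M w"
proof -
  define q where "q = cmod (w - z) / \<bar>Im z\<bar>"
  have y: "\<bar>Im z\<bar> > 0" using w by (smt (verit) norm_ge_zero)
  have q: "0 \<le> q" "q < 1" using w y by (auto simp: q_def)
  define f where "f = (\<lambda>j x. 1 / (complex_of_real x - z) ^ Suc j * (w - z) ^ j)"
  have nz: "complex_of_real x - z \<noteq> 0" for x
    using abs_Im_le_cmod_diff[of z x] y by auto
  have f_bound: "norm (f j x) \<le> q ^ j / \<bar>Im z\<bar>" for j x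
  proof -
    have "norm (f j x) = cmod (w - z) ^ j / cmod (of_real x - z) ^ Suc j"
      by (simp add: f_def norm_divide norm_mult norm_power)
    also have "\<dots> \<le> cmod (w - z) ^ j / \<bar>Im z\<bar> ^ Suc j"
      by (intro divide_left_mono power_mono abs_Im_le_cmod_diff mult_pos_pos zero_less_power)
         (use y nz in auto)
    finally show ?thesis by (simp add: q_def power_divide mult.commute)
  qed
  have int: "integrable M (f j)" for j
    by (rule integrable_bounded_continuous[OF _ f_bound])
       (unfold f_def, intro continuous_intros ballI, use nz in simp)
  have geo: "summable (\<lambda>j. q ^ j / \<bar>Im z\<bar>)"
    using q by (intro summable_divide summable_geometric) auto
  have "(\<lambda>j. integral\<^sup>L M (f j)) sums (LINT x|M. (\<Sum>j. f j x))"
  proof (rule sums_integral[OF int])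
    show "AE x in M. summable (\<lambda>j. norm (f j x))"
      by (intro AE_I2 summable_comparison_test'[OF geo, of 0]) (use f_bound in auto)
    show "summable (\<lambda>j. LINT x|M. norm (f j x))"
    proof (rule summable_comparison_test'[of "\<lambda>j. measure M (space M) * (q ^ j / \<bar>Im z\<bar>)" 0])
      show "summable (\<lambda>j. measure M (space M) * (q ^ j / \<bar>Im z\<bar>))"
        using geo by (rule summable_mult)
      fix j
      have "(LINT x|M. norm (f j x)) \<le> (LINT x|M. q ^ j / \<bar>Im z\<bar>)"
        using int f_bound by (intro integral_mono) auto
      then show "norm (LINT x|M. norm (f j x)) \<le> measure M (space M) * (q ^ j / \<bar>Im z\<bar>)"
        by simp
    qed
  qed
  moreover have "(\<Sum>j. f j x) = 1 / (of_real x - w)" for x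
  proof -
    let ?d = "complex_of_real x - z"
    have "cmod ((w - z) / ?d) < 1"
      using w abs_Im_le_cmod_diff[of z x] nz[of x] by (simp add: norm_divide)
    from sums_mult[OF geometric_sums[OF this], of "1 / ?d"]
    have "(\<lambda>j. f j x) sums (1 / ?d * (1 / (1 - (w - z) / ?d)))"
      by (simp add: f_def power_divide field_simps)
    also have "1 / ?d * (1 / (1 - (w - z) / ?d)) = 1 / (of_real x - w)"
      using nz[of x] by (simp add: divide_simps)
    finally show ?thesis by (simp add: sums_iff)
  qed
  moreover have "integral\<^sup>L M (f j) = (LINT x|M. 1 / (of_real x - z) ^ Suc j) * (w - z) ^ j" for j
    unfolding f_def by (rule integral_mult_left_zero)
  ultimately show ?thesis
    by (simp add: cauchy_transform_def)
qed

lemma (in finite_borel_measure) higher_deriv_cauchy_transform: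
  assumes "Im z \<noteq> 0"
  shows "(deriv ^^ j) (cauchy_transform M) z = fact j * (LINT x|M. 1 / (of_real x - z) ^ Suc j)"
proof (rule higher_deriv_power_series)
  show "\<bar>Im z\<bar> > 0"
    using assms by simp
  show "(\<lambda>n. (LINT x|M. 1 / (of_real x - z) ^ Suc n) * (w - z) ^ n) sums cauchy_transform M w"
    if "w \<in> ball z \<bar>Im z\<bar>" for w
    by (rule cauchy_transform_sums) (use that in \<open>simp add: dist_norm norm_minus_commute\<close>)
qed

lemma open_upper_half_plane: "open upper_half_plane"
  unfolding upper_half_plane_def by (rule open_halfspace_Im_gt)

lemma (in finite_borel_measure) cauchy_transform_holomorphic:
  "cauchy_transform M holomorphic_on upper_half_plane"
proof (rule holomorphic_onI)
  fix z assume z: "z \<in> upper_half_plane"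
  have "cauchy_transform M holomorphic_on ball z \<bar>Im z\<bar>"
  proof (rule power_series_holomorphic)
    show "(\<lambda>n. (LINT x|M. 1 / (of_real x - z) ^ Suc n) * (w - z) ^ n) sums cauchy_transform M w"
      if "w \<in> ball z \<bar>Im z\<bar>" for w
      by (rule cauchy_transform_sums) (use that in \<open>simp add: dist_norm norm_minus_commute\<close>)
  qed
  then have "cauchy_transform M field_differentiable at z"
    by (rule holomorphic_on_imp_differentiable_at) (use z in \<open>auto simp: upper_half_plane_def\<close>)
  then show "cauchy_transform M field_differentiable at z within upper_half_plane"
    by (rule field_differentiable_at_within)
qed

section \<open>Vague sequential compactness on the line\<close>

lemma (in finite_borel_measure) norm_integral_le_mass:
  fixes f :: "real \<Rightarrow> 'b::{banach, second_countable_topology}"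
  assumes "continuous_on UNIV f" and "\<And>x. norm (f x) \<le> B"
  shows "norm (integral\<^sup>L M f) \<le> B * measure M UNIV"
proof -
  have "norm (integral\<^sup>L M f) \<le> (LINT x|M. norm (f x))"
    by (rule integral_norm_bound)
  also have "\<dots> \<le> (LINT x|M. B)"
    by (intro integral_mono integrable_norm integrable_bounded_continuous[OF assms]) (use assms in auto)
  also have "\<dots> = B * measure M UNIV"
    using sets_eq_imp_space_eq[OF M_is_borel] by simp
  finally show ?thesis .
qed

lemma continuous_vanishing_bounded:
  fixes f :: "real \<Rightarrow> 'b::real_normed_vector"
  assumes "f \<in> continuous_vanishing"
  obtains B where "B \<ge> 0" "\<And>x. norm (f x) \<le> B"
proof -
  have cont: "continuous_on UNIV f" and top: "(f \<longlongrightarrow> 0) at_top" and bot: "(f \<longlongrightarrow> 0) at_bot"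
    using assms by (auto simp: continuous_vanishing_def)
  obtain b where b: "\<And>x. x \<ge> b \<Longrightarrow> norm (f x) < 1"
    using tendstoD[OF top, of 1] by (auto simp: eventually_at_top_linorder)
  obtain a where a: "\<And>x. x \<le> a \<Longrightarrow> norm (f x) < 1"
    using tendstoD[OF bot, of 1] by (auto simp: eventually_at_bot_linorder)
  have "compact (f ` {a..b})"
    using cont by (intro compact_continuous_image) (auto intro: continuous_on_subset)
  then have "bounded (f ` {a..b})"
    by (rule compact_imp_bounded)
  then obtain C where C: "\<And>x. x \<in> {a..b} \<Longrightarrow> norm (f x) \<le> C"
    unfolding bounded_iff by fastforce
  have "norm (f x) \<le> max 1 C" for x
    using a[of x] b[of x] C[of x] by (cases "x \<le> a"; cases "x \<ge> b") auto
  then show ?thesis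
    using that[of "max 1 C"] by auto
qed

text \<open>
  In the coordinate \<open>t = arctan x\<close> the endpoints \<open>- (pi / 2)\<close> and \<open>pi / 2\<close> play the role of the two
  infinities, so vanishing at infinity becomes continuity of the extension by zero.
\<close>

lemma isCont_arctan_chart:
  fixes f :: "real \<Rightarrow> 'b::real_normed_vector"
  assumes "f \<in> continuous_vanishing"
  shows "isCont (\<lambda>t. if \<bar>t\<bar> < pi / 2 then f (tan t) else 0) t"
    (is "isCont ?F t")
proof -
  have cont: "isCont f x" for x
    using assms by (auto simp: continuous_vanishing_def continuous_on_eq_continuous_at)
  have top: "(f \<longlongrightarrow> 0) at_top" and bot: "(f \<longlongrightarrow> 0) at_bot"
    using assms by (auto simp: continuous_vanishing_def)
  have outside: "(?F \<longlongrightarrow> 0) (at_right (pi / 2))" "(?F \<longlongrightarrow> 0) (at_left (- (pi / 2)))"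
  proof -
    have "\<forall>\<^sub>F t in at_right (pi / 2). ?F t = 0"
      by (rule eventually_at_rightI[of _ "pi / 2 + 1"]) auto
    then show "(?F \<longlongrightarrow> 0) (at_right (pi / 2))"
      by (rule tendsto_eventually)
    have "\<forall>\<^sub>F t in at_left (- (pi / 2)). ?F t = 0"
      by (rule eventually_at_leftI[of "- (pi / 2) - 1"]) auto
    then show "(?F \<longlongrightarrow> 0) (at_left (- (pi / 2)))"
      by (rule tendsto_eventually)
  qed
  consider "\<bar>t\<bar> < pi / 2" | "\<bar>t\<bar> > pi / 2" | "t = pi / 2" | "t = - (pi / 2)"
    by linarith
  then show ?thesis
  proof cases
    case 1
    have "cos t \<noteq> 0"
      using 1 cos_gt_zero_pi[of t] by linarith
    then have "isCont (\<lambda>t. f (tan t)) t"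
      by (intro isCont_o2[OF isCont_tan cont])
    moreover have "\<forall>\<^sub>F s in nhds t. ?F s = f (tan s)"
      using 1 by (intro eventually_nhds_in_open[of "{- (pi / 2) <..< pi / 2}", THEN eventually_mono]) auto
    ultimately show ?thesis
      by (subst isCont_cong)
  next
    case 2
    have "\<forall>\<^sub>F s in nhds t. ?F s = 0"
      using 2 by (intro eventually_nhds_in_open[of "- {- (pi / 2) .. pi / 2}", THEN eventually_mono]) auto
    then have "isCont ?F t = isCont (\<lambda>_. 0::'b) t"
      by (rule isCont_cong)
    then show ?thesis by simp
  next
    case 3
    have "\<forall>\<^sub>F t in at_left (pi / 2). t \<in> {0<..<pi / 2}"
      by (rule eventually_at_leftI[of 0]) auto
    then have "\<forall>\<^sub>F t in at_left (pi / 2). f (tan t) = ?F t"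
      by eventually_elim auto
    from Lim_transform_eventually[OF filterlim_compose[OF top filterlim_tan_at_left] this]
    have "(?F \<longlongrightarrow> 0) (at_left (pi / 2))" .
    then have "(?F \<longlongrightarrow> 0) (at (pi / 2))"
      unfolding filterlim_at_split using outside by blast
    then show ?thesis
      unfolding isCont_def 3 by simp
  next
    case 4
    have "\<forall>\<^sub>F t in at_right (- (pi / 2)). t \<in> {- (pi / 2)<..<0}"
      by (rule eventually_at_rightI[of _ 0]) auto
    then have "\<forall>\<^sub>F t in at_right (- (pi / 2)). f (tan t) = ?F t"
      by eventually_elim auto
    from Lim_transform_eventually[OF filterlim_compose[OF bot filterlim_tan_at_right] this]
    have "(?F \<longlongrightarrow> 0) (at_right (- (pi / 2)))" .
    then have "(?F \<longlongrightarrow> 0) (at (- (pi / 2)))"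
      unfolding filterlim_at_split using outside by blast
    then show ?thesis
      unfolding isCont_def 4 by simp
  qed
qed

text \<open>
  The images of the normalised measures under \<open>arctan\<close> live on a fixed bounded interval, so they
  are tight whatever the behaviour of the original measures at infinity, and a subsequence converges
  weakly. Its limit may charge the endpoints; discarding that part and
  transporting the rest back by \<open>tan\<close> gives the vague limit, and explains why mass can be lost.
\<close>
theorem vague_sequential_compactness:
  fixes \<mu> :: "nat \<Rightarrow> real measure"
  assumes fin: "\<And>n. finite_borel_measure (\<mu> n)"
    and mass: "(\<lambda>n. measure (\<mu> n) UNIV) \<longlonglongrightarrow> m"
  obtains r \<tau> where "strict_mono (r :: nat \<Rightarrow> nat)" "finite_borel_measure \<tau>" "measure \<tau> UNIV \<le> m"
    and "\<And>f :: real \<Rightarrow> complex. f \<in> continuous_vanishing \<Longrightarrow>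
      (\<lambda>n. integral\<^sup>L (\<mu> (r n)) f) \<longlonglongrightarrow> integral\<^sup>L \<tau> f"
proof (cases "m = 0")
  \<comment> \<open>Measures whose masses tend to zero cannot be normalised; they converge to the zero measure.\<close>
  case True
  have "(\<lambda>n. integral\<^sup>L (\<mu> n) f) \<longlonglongrightarrow> 0" if f: "f \<in> continuous_vanishing"
    for f :: "real \<Rightarrow> complex"
  proof -
    obtain B where B: "\<And>x. norm (f x) \<le> B"
      using continuous_vanishing_bounded[OF f] by blast
    show ?thesis
    proof (rule Lim_null_comparison)
      show "\<forall>\<^sub>F n in sequentially. norm (integral\<^sup>L (\<mu> n) f) \<le> B * measure (\<mu> n) UNIV"
        using f by (intro always_eventually allI finite_borel_measure.norm_integral_le_mass[OF fin _ B])
          (auto simp: continuous_vanishing_def)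
      show "(\<lambda>n. B * measure (\<mu> n) UNIV) \<longlonglongrightarrow> 0"
        using tendsto_mult_left[OF mass, of B] True by simp
    qed
  qed
  moreover have "finite_borel_measure (null_measure borel)"
    by (intro finite_borel_measure.intro finite_measureI finite_borel_measure_axioms.intro) simp_all
  ultimately show ?thesis
    using True by (intro that[of "\<lambda>n. n" "null_measure borel"]) (auto simp: strict_mono_def measure_def)
next
  case False
  have "m \<ge> 0"
    by (rule LIMSEQ_le_const[OF mass]) auto
  with False have m: "m > 0" by simp
  then obtain N where N: "\<And>n. n \<ge> N \<Longrightarrow> measure (\<mu> n) UNIV > 0"
    using order_tendstoD(1)[OF mass m] by (auto simp: eventually_sequentially)
  define c where "c n = measure (\<mu> (n + N)) UNIV" for n
  have c: "c n > 0" for n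
    using N by (simp add: c_def)
  define D where "D n = density (\<mu> (n + N)) (\<lambda>_. ennreal (1 / c n))" for n
  have sets_\<mu>: "sets (\<mu> n) = sets borel" and space_\<mu>: "space (\<mu> n) = UNIV" for n
    using finite_borel_measure.M_is_borel[OF fin, of n] sets_eq_imp_space_eq by fastforce+
  have [measurable_cong]: "sets (D n) = sets borel" for n
    by (simp add: D_def sets_\<mu>)
  have prob_D: "prob_space (D n)" for n
  proof
    interpret finite_borel_measure "\<mu> (n + N)" by (rule fin)
    have "emeasure (D n) (space (D n)) = ennreal (1 / c n) * emeasure (\<mu> (n + N)) UNIV"
      by (simp add: D_def space_\<mu> emeasure_density_const sets_\<mu>)
    also have "\<dots> = ennreal (1 / c n * c n)"
      using c[of n] by (simp add: emeasure_eq_measure c_def ennreal_mult[symmetric])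
    finally show "emeasure (D n) (space (D n)) = 1"
      using c[of n] by simp
  qed
  \<comment> \<open>\<open>D n\<close> is normalised to total mass one; \<open>P n\<close> is its image in the bounded coordinate.\<close>
  define P where "P n = distr (D n) borel arctan" for n
  have arctan_D: "arctan \<in> borel_measurable (D n)" for n
    by measurable
  have P: "real_distribution (P n)" for n
    unfolding P_def by (rule prob_space.real_distribution_distr[OF prob_D arctan_D])
  have "measure (P n) {- 2<..2} = 1" for n
  proof -
    interpret prob_space "D n" by (rule prob_D)
    have "arctan x \<in> {- 2<..2}" for x
      using arctan_lbound[of x] arctan_ubound[of x] pi_half_less_two by auto
    then have "arctan -` {- 2<..2} \<inter> space (D n) = space (D n)"
      by auto
    then show ?thesis
      unfolding P_def by (subst measure_distr[OF arctan_D]) (simp_all add: prob_space)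
  qed
  then have "tight P"
    unfolding tight_def using P
    by (intro conjI allI impI exI[of _ "-2::real"] exI[of _ "2::real"]) simp_all
  from tight_imp_convergent_subsubsequence[OF this, of "\<lambda>n. n"]
  obtain r M where r: "strict_mono (r :: nat \<Rightarrow> nat)" and M: "real_distribution M"
    and weak: "weak_conv_m (\<lambda>n. P (r n)) M"
    by (auto simp: strict_mono_def o_def)
  interpret M: real_distribution M by (rule M)
  let ?I = "{- (pi / 2) <..< pi / 2}"
  \<comment> \<open>The density removes the mass at the endpoints and undoes the normalisation.\<close>
  define E where "E = density M (\<lambda>t. ennreal (m * indicator ?I t))"
  define \<tau> where "\<tau> = distr E borel tan"
  have tan_M: "tan \<in> borel_measurable M"
    unfolding tan_def by measurable
  then have tan_E: "tan \<in> borel_measurable E"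
    by (simp add: E_def)
  have mass_\<tau>: "emeasure \<tau> UNIV \<le> ennreal m"
  proof -
    have "emeasure \<tau> UNIV = emeasure E (space E)"
      unfolding \<tau>_def by (subst emeasure_distr[OF tan_E]) auto
    also have "\<dots> = (\<integral>\<^sup>+t. ennreal (m * indicator ?I t) \<partial>M)"
      unfolding E_def by (subst emeasure_density) (auto intro!: nn_integral_cong)
    also have "\<dots> \<le> (\<integral>\<^sup>+t. ennreal m \<partial>M)"
      using m by (intro nn_integral_mono) (auto split: split_indicator)
    finally show ?thesis
      using M.emeasure_space_1 by simp
  qed
  have \<tau>: "finite_borel_measure \<tau>"
  proof (intro finite_borel_measure.intro finite_measureI finite_borel_measure_axioms.intro)
    show "emeasure \<tau> (space \<tau>) \<noteq> \<infinity>"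
      using mass_\<tau> by (auto simp: \<tau>_def top_unique)
  qed (simp add: \<tau>_def)
  interpret \<tau>: finite_borel_measure \<tau> by (rule \<tau>)
  have "measure \<tau> UNIV \<le> m"
    using mass_\<tau> m by (simp add: \<tau>.emeasure_eq_measure)
  moreover have "(\<lambda>n. integral\<^sup>L (\<mu> (r n + N)) f) \<longlonglongrightarrow> integral\<^sup>L \<tau> f"
    if f: "f \<in> continuous_vanishing" for f :: "real \<Rightarrow> complex"
  proof -
    define F where "F t = (if \<bar>t\<bar> < pi / 2 then f (tan t) else 0)" for t
    have F: "isCont F t" for t
      using isCont_arctan_chart[OF f] unfolding F_def .
    then have F_meas [measurable]: "F \<in> borel_measurable borel"
      by (intro borel_measurable_continuous_onI continuous_at_imp_continuous_on) auto
    have f_meas [measurable]: "f \<in> borel_measurable borel"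
      using f by (intro borel_measurable_continuous_onI) (auto simp: continuous_vanishing_def)
    obtain B where "B \<ge> 0" "\<And>x. norm (f x) \<le> B"
      using continuous_vanishing_bounded[OF f] by blast
    then have F_bound: "norm (F t) \<le> B" for t
      by (simp add: F_def)
    have "integral\<^sup>L (P n) F = integral\<^sup>L (\<mu> (n + N)) f / of_real (c n)" for n
    proof -
      have F_arctan: "F (arctan x) = f x" for x
        using arctan_lbound[of x] arctan_ubound[of x] by (simp add: F_def abs_less_iff tan_arctan)
      have "integral\<^sup>L (P n) F = integral\<^sup>L (D n) f"
        unfolding P_def by (subst integral_distr[OF arctan_D]) (simp_all add: F_arctan)
      also have "\<dots> = (LINT x|\<mu> (n + N). (1 / c n) *\<^sub>R f x)"
        unfolding D_def using c[of n] f_meas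
        by (intro integral_density) (auto simp: measurable_cong_sets[OF sets_\<mu> refl])
      finally show ?thesis
        by (simp add: scaleR_conv_of_real)
    qed
    moreover have "(\<lambda>n. integral\<^sup>L (P (r n)) F) \<longlonglongrightarrow> integral\<^sup>L M F"
      by (rule weak_conv_imp_integral_bdd_continuous_conv[OF P M weak F F_bound])
    moreover have "(\<lambda>n. of_real (c (r n)) :: complex) \<longlonglongrightarrow> of_real m"
      using LIMSEQ_subseq_LIMSEQ[OF LIMSEQ_ignore_initial_segment[OF mass] r, of N]
      by (intro tendsto_of_real) (simp add: c_def o_def)
    ultimately have "(\<lambda>n. integral\<^sup>L (\<mu> (r n + N)) f / of_real (c (r n)) * of_real (c (r n)))
        \<longlonglongrightarrow> integral\<^sup>L M F * of_real m"
      by (intro tendsto_mult) simp_all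
    moreover have "complex_of_real (c n) \<noteq> 0" for n
      using c[of n] by simp
    moreover have "integral\<^sup>L \<tau> f = integral\<^sup>L M F * of_real m"
    proof -
      have "integral\<^sup>L \<tau> f = (LINT t|E. f (tan t))"
        unfolding \<tau>_def by (rule integral_distr[OF tan_E]) simp
      also have "\<dots> = (LINT t|M. (m * indicator ?I t) *\<^sub>R f (tan t))"
        unfolding E_def using m measurable_compose[OF tan_M f_meas]
        by (intro integral_density) auto
      also have "\<dots> = (LINT t|M. of_real m * F t)"
        by (intro Bochner_Integration.integral_cong)
           (auto simp: F_def scaleR_conv_of_real abs_less_iff split: split_indicator)
      finally show ?thesis by simp
    qed
    ultimately show ?thesis by simp
  qed
  moreover have "strict_mono (\<lambda>n. r n + N)"
    using r by (auto simp: strict_mono_def)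
  ultimately show ?thesis
    using that[of "\<lambda>n. r n + N" \<tau>] \<tau> by blast
qed

section \<open>Convergence of trigonometric moments on the circle\<close>

context
  fixes M :: "nat \<Rightarrow> 'a measure" and v :: "'a \<Rightarrow> complex"
  assumes fin: "\<And>n. finite_measure (M n)"
    and meas: "\<And>n. v \<in> borel_measurable (M n)"
    and unit: "\<And>x. cmod (v x) = 1"
begin

lemma integrable_on_circle:
  fixes h :: "complex \<Rightarrow> 'b::{banach, second_countable_topology}"
  assumes h: "continuous_on (sphere 0 1) h"
  shows "integrable (M n) (\<lambda>x. h (v x))"
proof -
  interpret finite_measure "M n" by (rule fin)
  have "compact (h ` sphere 0 1)"
    using h by (intro compact_continuous_image) auto
  then have "bounded (h ` sphere 0 1)"
    by (rule compact_imp_bounded)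
  then obtain B where B: "\<And>z. z \<in> sphere 0 1 \<Longrightarrow> norm (h z) \<le> B"
    unfolding bounded_iff by fastforce
  have "v \<in> measurable (M n) (restrict_space borel (sphere 0 1))"
    using meas unit by (intro measurable_restrict_space2) auto
  moreover have "h \<in> borel_measurable (restrict_space borel (sphere 0 1))"
    by (rule borel_measurable_continuous_on_restrict[OF h])
  ultimately have "(\<lambda>x. h (v x)) \<in> borel_measurable (M n)"
    by (rule measurable_compose)
  then show ?thesis
    by (rule integrable_const_bound[rotated]) (use B unit in auto)
qed

text \<open>
  Testing against all integer powers makes this class of functions stable under multiplication by
  \<open>z\<close> and by \<open>1 / z\<close>. On the circle these two multiplications generate multiplication by every real
  polynomial in \<open>Re z\<close> and \<open>Im z\<close>.
\<close>
definition moments_converge :: "(complex \<Rightarrow> complex) \<Rightarrow> bool" where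
  "moments_converge \<phi> \<longleftrightarrow> continuous_on (sphere 0 1) \<phi> \<and>
     (\<forall>k::int. convergent (\<lambda>n. LINT x|M n. \<phi> (v x) * v x powi k))"

lemma continuous_on_circle_powi:
  assumes "continuous_on (sphere 0 1) \<phi>"
  shows "continuous_on (sphere 0 1) (\<lambda>z::complex. \<phi> z * z powi k)"
  using assms by (intro continuous_intros) auto

lemma moments_converge_add:
  assumes "moments_converge \<phi>" and "moments_converge \<psi>"
  shows "moments_converge (\<lambda>z. \<phi> z + \<psi> z)"
proof -
  have "(LINT x|M n. (\<phi> (v x) + \<psi> (v x)) * v x powi k) =
      (LINT x|M n. \<phi> (v x) * v x powi k) + (LINT x|M n. \<psi> (v x) * v x powi k)" for n k
    unfolding distrib_right using assms unfolding moments_converge_def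
    by (intro Bochner_Integration.integral_add integrable_on_circle continuous_on_circle_powi) auto
  then show ?thesis
    using assms unfolding moments_converge_def
    by (auto intro!: continuous_intros convergent_add)
qed

lemma moments_converge_cmult:
  assumes "moments_converge \<phi>"
  shows "moments_converge (\<lambda>z. c * \<phi> z)"
  using assms unfolding moments_converge_def mult.assoc
  by (auto intro!: continuous_intros convergent_mult convergent_const)

lemma moments_converge_shift:
  assumes "moments_converge \<phi>"
  shows "moments_converge (\<lambda>z. z powi j * \<phi> z)"
proof -
  have "z powi j * \<phi> z * z powi k = \<phi> z * z powi (j + k)" if "cmod z = 1" for z k
    using that by (subst power_int_add) (auto simp: mult_ac)
  then have "(LINT x|M n. v x powi j * \<phi> (v x) * v x powi k) =
      (LINT x|M n. \<phi> (v x) * v x powi (j + k))" for n k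
    using unit by (intro Bochner_Integration.integral_cong) auto
  moreover have "continuous_on (sphere 0 1) (\<lambda>z. z powi j * \<phi> z)"
    using assms unfolding moments_converge_def by (intro continuous_intros) auto
  ultimately show ?thesis
    using assms unfolding moments_converge_def by auto
qed

text \<open>
  Generalising over \<open>\<phi>\<close> is what lets the induction pass through products: a product of polynomials acts
  by two successive multiplications. For the linear case, \<open>Re z\<close> and \<open>Im z\<close> are combinations of \<open>z\<close>
  and \<open>cnj z = 1 / z\<close>.
\<close>
lemma moments_converge_polynomial:
  assumes "real_polynomial_function p" and "moments_converge \<phi>"
  shows "moments_converge (\<lambda>z. of_real (p z) * \<phi> z)"
  using assms
proof (induction arbitrary: \<phi> rule: real_polynomial_function.induct)
  case (linear f)
  interpret f: bounded_linear f by (rule linear)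
  define a where "a = (of_real (f 1) - \<i> * of_real (f \<i>)) / 2"
  define b where "b = (of_real (f 1) + \<i> * of_real (f \<i>)) / 2"
  have f_eq: "of_real (f z) = a * z + b * cnj z" for z
  proof -
    have "z = Re z *\<^sub>R 1 + Im z *\<^sub>R \<i>"
      by (simp add: complex_eq_iff)
    then have "f z = Re z * f 1 + Im z * f \<i>"
      by (metis f.add f.scaleR real_scaleR_def)
    then show ?thesis
      by (simp add: a_def b_def complex_eq_iff field_simps)
  qed
  have circle: "of_real (f z) * \<phi> z = a * (z powi 1 * \<phi> z) + b * (z powi - 1 * \<phi> z)"
    if "cmod z = 1" for z
  proof -
    have "cnj z = z powi - 1"
      using that by (simp add: power_int_minus inverse_eq_divide divide_conv_cnj)
    then show ?thesis
      by (simp add: f_eq algebra_simps)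
  qed
  have "moments_converge (\<lambda>z. a * (z powi 1 * \<phi> z) + b * (z powi - 1 * \<phi> z))"
    using linear by (intro moments_converge_add moments_converge_cmult moments_converge_shift)
  moreover have "continuous_on (sphere 0 1) (\<lambda>z. of_real (f z) * \<phi> z) \<longleftrightarrow>
      continuous_on (sphere 0 1) (\<lambda>z. a * (z powi 1 * \<phi> z) + b * (z powi - 1 * \<phi> z))"
    by (intro continuous_on_cong circle) auto
  ultimately show ?case
    unfolding moments_converge_def by (simp only: circle[OF unit] simp_thms)
next
  case (const c)
  then show ?case by (rule moments_converge_cmult)
next
  case (add p q)
  then have "moments_converge (\<lambda>z. of_real (p z) * \<phi> z + of_real (q z) * \<phi> z)"
    by (intro moments_converge_add)
  then show ?case by (simp add: distrib_right)
next
  case (mult p q)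
  then have "moments_converge (\<lambda>z. of_real (p z) * (of_real (q z) * \<phi> z))"
    by blast
  then show ?case by (simp add: mult.assoc)
qed

context
  assumes moments: "\<And>k::nat. convergent (\<lambda>n. LINT x|M n. v x ^ k)"
begin

text \<open>
  Convergence of the nonnegative moments is enough, because \<open>1 / v = cnj v\<close> makes the negative ones their
  conjugates.
\<close>
lemma moments_converge_one: "moments_converge (\<lambda>_. 1)"
proof -
  have "convergent (\<lambda>n. LINT x|M n. v x powi k)" for k
  proof (cases "k \<ge> 0")
    case True
    then show ?thesis
      using moments[of "nat k"] by (simp add: power_int_def)
  next
    case False
    have "inverse (v x) = cnj (v x)" for x
      using unit[of x] by (simp add: inverse_eq_divide divide_conv_cnj)
    then have "v x powi k = cnj (v x ^ nat (- k))" for x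
      using False by (simp add: power_int_def)
    then have "(LINT x|M n. v x powi k) = cnj (LINT x|M n. v x ^ nat (- k))" for n
      by (simp only: Bochner_Integration.integral_cnj)
    with moments[of "nat (- k)"] show ?thesis
      by (auto simp: convergent_def intro!: tendsto_cnj)
  qed
  then show ?thesis
    by (simp add: moments_converge_def)
qed

text \<open>
  Real polynomials are uniformly dense in the continuous functions on the circle, and the masses are
  bounded because they are the moments of order zero; so the integrals of \<open>h \<circ> v\<close> form a Cauchy
  sequence.
\<close>
lemma convergent_integral_circle_real:
  fixes h :: "complex \<Rightarrow> real"
  assumes h: "continuous_on (sphere 0 1) h"
  shows "convergent (\<lambda>n. LINT x|M n. h (v x))"
proof -
  have poly: "convergent (\<lambda>n. LINT x|M n. p (v x))" if p: "real_polynomial_function p" for p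
  proof -
    have "convergent (\<lambda>n. LINT x|M n. complex_of_real (p (v x)))"
      using moments_converge_polynomial[OF p moments_converge_one]
      unfolding moments_converge_def by (auto dest!: spec[of _ 0])
    then obtain l where "(\<lambda>n. complex_of_real (LINT x|M n. p (v x))) \<longlonglongrightarrow> l"
      by (auto simp: convergent_def)
    from tendsto_Re[OF this] show ?thesis
      by (auto simp: convergent_def)
  qed
  have "convergent (\<lambda>n. measure (M n) (space (M n)))"
    using poly[of "\<lambda>_. 1"] by (auto intro: real_polynomial_function.intros)
  then have "Bseq (\<lambda>n. measure (M n) (space (M n)))"
    by (rule convergent_imp_Bseq)
  then obtain K where K: "K > 0" "\<And>n. measure (M n) (space (M n)) \<le> K"
    by (auto simp: Bseq_def)
  have "Cauchy (\<lambda>n. LINT x|M n. h (v x))"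
  proof (rule metric_CauchyI)
    fix e :: real assume e: "e > 0"
    obtain p where p: "real_polynomial_function p"
      and close: "\<And>z. z \<in> sphere 0 1 \<Longrightarrow> \<bar>h z - p z\<bar> < e / (3 * K)"
      using Stone_Weierstrass_real_polynomial_function[OF _ h, of "e / (3 * K)"] e K by auto
    have cont_p: "continuous_on (sphere 0 1) p"
      using p by (rule continuous_on_polymonial_function[OF real_polynomial_function_eq[THEN iffD1]])
    have dist_le: "dist (LINT x|M n. h (v x)) (LINT x|M n. p (v x)) \<le> e / 3" for n
    proof -
      interpret finite_measure "M n" by (rule fin)
      have "dist (LINT x|M n. h (v x)) (LINT x|M n. p (v x)) = \<bar>LINT x|M n. h (v x) - p (v x)\<bar>"
        unfolding dist_real_def
        by (subst Bochner_Integration.integral_diff) (auto intro!: integrable_on_circle h cont_p)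
      also have "\<dots> \<le> (LINT x|M n. \<bar>h (v x) - p (v x)\<bar>)"
        by (rule integral_abs_bound)
      also have "\<dots> \<le> (LINT x|M n. e / (3 * K))"
        using close unit by (intro integral_mono integrable_abs Bochner_Integration.integrable_diff
          integrable_on_circle h cont_p) (auto intro: less_imp_le)
      also have "\<dots> = e / (3 * K) * measure (M n) (space (M n))"
        by simp
      also have "\<dots> \<le> e / (3 * K) * K"
        using K e by (intro mult_left_mono) auto
      also have "\<dots> = e / 3"
        using K by simp
      finally show ?thesis .
    qed
    obtain N where N: "\<And>m n. m \<ge> N \<Longrightarrow> n \<ge> N \<Longrightarrow>
        dist (LINT x|M m. p (v x)) (LINT x|M n. p (v x)) < e / 3"
      using metric_CauchyD[OF convergent_Cauchy[OF poly[OF p]], of "e / 3"] e by auto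
    have "dist (LINT x|M m. h (v x)) (LINT x|M n. h (v x)) < e" if "m \<ge> N" "n \<ge> N" for m n
      using dist_le[of m] dist_le[of n] N[OF that] unfolding dist_real_def by linarith
    then show "\<exists>N. \<forall>m\<ge>N. \<forall>n\<ge>N. dist (LINT x|M m. h (v x)) (LINT x|M n. h (v x)) < e"
      by blast
  qed
  then show ?thesis
    by (rule Cauchy_convergent)
qed

theorem convergent_integral_circle:
  fixes h :: "complex \<Rightarrow> complex"
  assumes h: "continuous_on (sphere 0 1) h"
  shows "convergent (\<lambda>n. LINT x|M n. h (v x))"
proof -
  have "convergent (\<lambda>n. LINT x|M n. Re (h (v x)))" "convergent (\<lambda>n. LINT x|M n. Im (h (v x)))"
    using h by (auto intro!: convergent_integral_circle_real continuous_intros)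
  then obtain a b where lim: "(\<lambda>n. LINT x|M n. Re (h (v x))) \<longlonglongrightarrow> a"
    "(\<lambda>n. LINT x|M n. Im (h (v x))) \<longlonglongrightarrow> b"
    by (auto simp: convergent_def)
  have "(LINT x|M n. h (v x)) = Complex (LINT x|M n. Re (h (v x))) (LINT x|M n. Im (h (v x)))" for n
    using integrable_on_circle[OF h] by (simp add: complex_eq_iff)
  with tendsto_Complex[OF lim] show ?thesis
    by (auto simp: convergent_def)
qed

end

end

section \<open>Vague convergence without loss of mass\<close>

lemma (in finite_borel_measure) cutoff_error:
  fixes f :: "real \<Rightarrow> complex" and \<kappa> :: "real \<Rightarrow> real"
  assumes f: "continuous_on UNIV f" "\<And>x. norm (f x) \<le> B"
    and \<kappa>: "continuous_on UNIV \<kappa>" "\<And>x. 0 \<le> \<kappa> x" "\<And>x. \<kappa> x \<le> 1"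
  shows "norm (integral\<^sup>L M f - (LINT x|M. f x * of_real (\<kappa> x))) \<le> B * (measure M UNIV - integral\<^sup>L M \<kappa>)"
proof -
  have B: "B \<ge> 0"
    using f(2)[of 0] norm_ge_zero[of "f 0"] by linarith
  have int_\<kappa>: "integrable M \<kappa>"
    using \<kappa> by (intro integrable_bounded_continuous[where B = 1]) auto
  have f\<kappa>: "norm (f x * of_real (\<kappa> x)) \<le> B" for x
    using mult_mono[OF f(2)[of x] \<kappa>(3)[of x] B \<kappa>(2)] \<kappa>(2) by (simp add: norm_mult)
  have int_f\<kappa>: "integrable M (\<lambda>x. f x * of_real (\<kappa> x))"
    using f \<kappa> by (intro integrable_bounded_continuous[OF _ f\<kappa>] continuous_intros)
  have int_f: "integrable M f"
    by (rule integrable_bounded_continuous[OF f])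
  have "integral\<^sup>L M f - (LINT x|M. f x * of_real (\<kappa> x)) = (LINT x|M. f x - f x * of_real (\<kappa> x))"
    by (rule Bochner_Integration.integral_diff[OF int_f int_f\<kappa>, symmetric])
  also have "norm \<dots> \<le> (LINT x|M. norm (f x - f x * of_real (\<kappa> x)))"
    by (rule integral_norm_bound)
  also have "\<dots> \<le> (LINT x|M. B * (1 - \<kappa> x))"
  proof (intro integral_mono integrable_norm Bochner_Integration.integrable_diff int_f int_f\<kappa>
      integrable_mult_right integrable_const int_\<kappa>)
    fix x
    have "norm (f x - f x * of_real (\<kappa> x)) = norm (f x * of_real (1 - \<kappa> x))"
      by (simp add: algebra_simps)
    also have "\<dots> = norm (f x) * (1 - \<kappa> x)"
      using \<kappa>(3)[of x] by (simp only: norm_mult norm_of_real abs_of_nonneg diff_ge_0_iff_ge)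
    also have "\<dots> \<le> B * (1 - \<kappa> x)"
      using f(2) \<kappa>(3) by (intro mult_right_mono) auto
    finally show "norm (f x - f x * of_real (\<kappa> x)) \<le> B * (1 - \<kappa> x)" .
  qed
  also have "\<dots> = B * (measure M UNIV - integral\<^sup>L M \<kappa>)"
    using sets_eq_imp_space_eq[OF M_is_borel] int_\<kappa> by simp
  finally show ?thesis .
qed

text \<open>
  With cutoffs \<open>\<kappa>\<^sub>k\<close> that vanish at infinity and increase to \<open>1\<close>, replacing \<open>f\<close> by \<open>f \<kappa>\<^sub>k\<close> costs at
  most \<open>B\<close> times the mass that \<open>1 - \<kappa>\<^sub>k\<close> sees (\<open>cutoff_error\<close>). For \<open>\<tau>\<close> this is small for large
  \<open>k\<close>; for \<open>\<mu>\<^sub>n\<close> it converges to the value for \<open>\<tau>\<close>, since the total masses and the integrals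
  of \<open>\<kappa>\<^sub>k\<close> both converge.
\<close>
theorem vague_limit_without_mass_loss:
  fixes \<mu> :: "nat \<Rightarrow> real measure" and f :: "real \<Rightarrow> complex"
  assumes fin: "\<And>n. finite_borel_measure (\<mu> n)" and \<tau>: "finite_borel_measure \<tau>"
    and vague: "\<And>f :: real \<Rightarrow> complex. f \<in> continuous_vanishing \<Longrightarrow>
      (\<lambda>n. integral\<^sup>L (\<mu> n) f) \<longlonglongrightarrow> integral\<^sup>L \<tau> f"
    and mass: "(\<lambda>n. measure (\<mu> n) UNIV) \<longlonglongrightarrow> measure \<tau> UNIV"
    and f: "f \<in> continuous_bounded"
  shows "(\<lambda>n. integral\<^sup>L (\<mu> n) f) \<longlonglongrightarrow> integral\<^sup>L \<tau> f"
proof -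
  interpret \<tau>: finite_borel_measure \<tau> by (rule \<tau>)
  have cont: "continuous_on UNIV f"
    using f by (simp add: continuous_bounded_def)
  obtain B where B: "\<And>x. norm (f x) \<le> B"
    using f by (auto simp: continuous_bounded_def bounded_iff)
  define \<kappa> :: "nat \<Rightarrow> real \<Rightarrow> real" where "\<kappa> k x = real (Suc k) / (real (Suc k) + \<bar>x\<bar>)" for k x
  have pos: "real (Suc k) + \<bar>x\<bar> \<noteq> 0" for k x
    by (smt (verit) of_nat_0_less_iff zero_less_Suc abs_ge_zero)
  have \<kappa>_cont: "continuous_on UNIV (\<kappa> k)" for k
    unfolding \<kappa>_def by (intro continuous_intros ballI pos)
  have \<kappa>_ge: "0 \<le> \<kappa> k x" and \<kappa>_le: "\<kappa> k x \<le> 1" for k x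
    by (auto simp: \<kappa>_def divide_simps)
  have \<kappa>_top: "(\<kappa> k \<longlongrightarrow> 0) at_top" and \<kappa>_bot: "(\<kappa> k \<longlongrightarrow> 0) at_bot" for k
    unfolding \<kappa>_def by real_asymp+
  have vanish: "(\<lambda>x. \<phi> x * complex_of_real (\<kappa> k x)) \<in> continuous_vanishing"
    if \<phi>: "continuous_on UNIV \<phi>" "\<And>x. norm (\<phi> x) \<le> C" for \<phi> :: "real \<Rightarrow> complex" and C k
  proof -
    have "((\<lambda>x. \<phi> x * complex_of_real (\<kappa> k x)) \<longlongrightarrow> 0) F" if "(\<kappa> k \<longlongrightarrow> 0) F" for F
    proof (rule Lim_null_comparison)
      show "\<forall>\<^sub>F x in F. norm (\<phi> x * complex_of_real (\<kappa> k x)) \<le> C * \<kappa> k x"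
        using \<phi>(2) \<kappa>_ge by (auto simp: norm_mult intro!: always_eventually mult_right_mono)
      show "((\<lambda>x. C * \<kappa> k x) \<longlongrightarrow> 0) F"
        using tendsto_mult_left[OF that, of C] by simp
    qed
    then show ?thesis
      using \<kappa>_top \<kappa>_bot \<phi>(1) \<kappa>_cont
      by (auto simp: continuous_vanishing_def intro!: continuous_intros)
  qed
  have \<kappa>_lim: "(\<lambda>n. integral\<^sup>L (\<mu> n) (\<kappa> k)) \<longlonglongrightarrow> integral\<^sup>L \<tau> (\<kappa> k)" for k
    using tendsto_Re[OF vague[OF vanish[of "\<lambda>_. 1" 1 k]]] by (simp add: continuous_on_const)
  have "(\<lambda>k. integral\<^sup>L \<tau> (\<kappa> k)) \<longlonglongrightarrow> (LINT x|\<tau>. 1)"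
  proof (rule integral_dominated_convergence[where w = "\<lambda>_. 1"])
    show "\<kappa> k \<in> borel_measurable \<tau>" for k
      using borel_measurable_continuous_onI[OF \<kappa>_cont[of k]] \<tau>.M_is_borel
      by (simp cong: measurable_cong_sets)
    have "(\<lambda>k. \<kappa> k x) \<longlonglongrightarrow> 1" for x
      unfolding \<kappa>_def by real_asymp
    then show "AE x in \<tau>. (\<lambda>k. \<kappa> k x) \<longlonglongrightarrow> 1"
      by simp
  qed (use \<kappa>_ge \<kappa>_le in auto)
  then have "(\<lambda>k. B * (measure \<tau> UNIV - integral\<^sup>L \<tau> (\<kappa> k))) \<longlonglongrightarrow> B * (measure \<tau> UNIV - measure \<tau> UNIV)"
    using sets_eq_imp_space_eq[OF \<tau>.M_is_borel] by (intro tendsto_intros) simp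
  then have cut: "(\<lambda>k. B * (measure \<tau> UNIV - integral\<^sup>L \<tau> (\<kappa> k))) \<longlonglongrightarrow> 0"
    by simp
  show ?thesis
  proof (rule tendstoI)
    fix e :: real assume e: "e > 0"
    obtain k where k: "B * (measure \<tau> UNIV - integral\<^sup>L \<tau> (\<kappa> k)) < e / 3"
      using order_tendstoD(2)[OF cut, of "e / 3"] e by (auto simp: eventually_sequentially)
    have "(\<lambda>n. B * (measure (\<mu> n) UNIV - integral\<^sup>L (\<mu> n) (\<kappa> k)))
        \<longlonglongrightarrow> B * (measure \<tau> UNIV - integral\<^sup>L \<tau> (\<kappa> k))"
      by (intro tendsto_intros mass \<kappa>_lim)
    from order_tendstoD(2)[OF this k]
    have "\<forall>\<^sub>F n in sequentially. B * (measure (\<mu> n) UNIV - integral\<^sup>L (\<mu> n) (\<kappa> k)) < e / 3" .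
    moreover have "\<forall>\<^sub>F n in sequentially.
        dist (LINT x|\<mu> n. f x * of_real (\<kappa> k x)) (LINT x|\<tau>. f x * of_real (\<kappa> k x)) < e / 3"
      using tendstoD[OF vague[OF vanish[OF cont B, of k]], of "e / 3"] e by simp
    ultimately show "\<forall>\<^sub>F n in sequentially. dist (integral\<^sup>L (\<mu> n) f) (integral\<^sup>L \<tau> f) < e"
    proof eventually_elim
      case (elim n)
      let ?a = "LINT x|\<mu> n. f x * of_real (\<kappa> k x)" and ?b = "LINT x|\<tau>. f x * of_real (\<kappa> k x)"
      have "dist (integral\<^sup>L (\<mu> n) f) ?a < e / 3"
        using finite_borel_measure.cutoff_error[OF fin cont B \<kappa>_cont \<kappa>_ge \<kappa>_le, of n k] elim(1)
        by (simp add: dist_norm)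
      moreover have "dist (integral\<^sup>L \<tau> f) ?b < e / 3"
        using \<tau>.cutoff_error[OF cont B \<kappa>_cont \<kappa>_ge \<kappa>_le, of k] k
        by (simp add: dist_norm)
      ultimately show ?case
        using elim(2) dist_triangle[of "integral\<^sup>L (\<mu> n) f" "integral\<^sup>L \<tau> f" ?a]
          dist_triangle[of ?a "integral\<^sup>L \<tau> f" ?b]
        by (simp add: dist_commute)
    qed
  qed
qed

section \<open>Weighting a measure by the Poisson kernel\<close>

text \<open>
  Up to the constant factor \<open>Im z / pi\<close> the density is the Poisson kernel of the upper half-plane at
  \<open>z\<close>.
\<close>

definition poisson_weighted :: "complex \<Rightarrow> real measure \<Rightarrow> real measure" where
  "poisson_weighted z \<omega> = density \<omega> (\<lambda>x. ennreal (1 / (cmod (of_real x - z))\<^sup>2))"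

lemma real_minus_nonreal_nonzero: "Im z \<noteq> 0 \<Longrightarrow> complex_of_real x - z \<noteq> 0"
  by (auto simp: complex_eq_iff)

lemma inverse_cmod_diff_le:
  assumes "Im z \<noteq> 0"
  shows "1 / cmod (complex_of_real x - z) \<le> 1 / \<bar>Im z\<bar>"
  using assms real_minus_nonreal_nonzero[OF assms, of x]
  by (intro divide_left_mono abs_Im_le_cmod_diff mult_pos_pos) auto

context finite_borel_measure
begin

lemma integrable_resolvent_power:
  assumes "Im z \<noteq> 0"
  shows "integrable M (\<lambda>x. 1 / (complex_of_real x - z) ^ j)"
proof (rule integrable_bounded_continuous)
  show "continuous_on UNIV (\<lambda>x. 1 / (complex_of_real x - z) ^ j)"
    by (intro continuous_intros ballI power_not_zero real_minus_nonreal_nonzero assms)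
  show "norm (1 / (complex_of_real x - z) ^ j) \<le> (1 / \<bar>Im z\<bar>) ^ j" for x
    using power_mono[OF inverse_cmod_diff_le[OF assms, of x], of j]
    by (simp add: norm_divide norm_power power_divide)
qed

lemma integrable_resolvent:
  "Im z \<noteq> 0 \<Longrightarrow> integrable M (\<lambda>x. 1 / (complex_of_real x - z))"
  using integrable_resolvent_power[of z 1] by simp

lemma continuous_poisson_weight:
  "Im z \<noteq> 0 \<Longrightarrow> continuous_on UNIV (\<lambda>x. 1 / (cmod (complex_of_real x - z))\<^sup>2)"
  using real_minus_nonreal_nonzero[of z] by (intro continuous_intros) auto

lemma integrable_poisson_weight:
  assumes "Im z \<noteq> 0"
  shows "integrable M (\<lambda>x. 1 / (cmod (complex_of_real x - z))\<^sup>2)"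
proof (rule integrable_bounded_continuous[OF continuous_poisson_weight[OF assms]])
  show "norm (1 / (cmod (complex_of_real x - z))\<^sup>2) \<le> (1 / \<bar>Im z\<bar>)\<^sup>2" for x
    using power_mono[OF inverse_cmod_diff_le[OF assms, of x], of 2]
    by (simp add: power_divide)
qed

lemma integral_poisson_weighted:
  fixes f :: "real \<Rightarrow> complex"
  assumes "Im z \<noteq> 0" and "continuous_on UNIV f"
  shows "integral\<^sup>L (poisson_weighted z M) f = (LINT x|M. f x / of_real ((cmod (of_real x - z))\<^sup>2))"
proof -
  have "f \<in> borel_measurable M" "(\<lambda>x. 1 / (cmod (complex_of_real x - z))\<^sup>2) \<in> borel_measurable M"
    using borel_measurable_continuous_onI[OF assms(2)]
      borel_measurable_continuous_onI[OF continuous_poisson_weight[OF assms(1)]] M_is_borel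
    by (simp_all cong: measurable_cong_sets)
  then have "integral\<^sup>L (poisson_weighted z M) f = (LINT x|M. (1 / (cmod (of_real x - z))\<^sup>2) *\<^sub>R f x)"
    unfolding poisson_weighted_def by (intro integral_density) auto
  then show ?thesis
    by (simp add: scaleR_conv_of_real mult.commute divide_inverse)
qed

lemma emeasure_poisson_weighted:
  assumes "Im z \<noteq> 0"
  shows "emeasure (poisson_weighted z M) UNIV = ennreal (LINT x|M. 1 / (cmod (of_real x - z))\<^sup>2)"
proof -
  have "emeasure (poisson_weighted z M) UNIV = (\<integral>\<^sup>+x. ennreal (1 / (cmod (of_real x - z))\<^sup>2) \<partial>M)"
    unfolding poisson_weighted_def using sets_eq_imp_space_eq[OF M_is_borel] M_is_borel
      borel_measurable_integrable[OF integrable_poisson_weight[OF assms]]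
    by (subst emeasure_density) auto
  also have "\<dots> = ennreal (LINT x|M. 1 / (cmod (of_real x - z))\<^sup>2)"
    by (rule nn_integral_eq_integral[OF integrable_poisson_weight[OF assms]]) simp
  finally show ?thesis .
qed

lemma finite_borel_measure_poisson_weighted:
  assumes "Im z \<noteq> 0"
  shows "finite_borel_measure (poisson_weighted z M)"
proof (intro finite_borel_measure.intro finite_measureI finite_borel_measure_axioms.intro)
  show "emeasure (poisson_weighted z M) (space (poisson_weighted z M)) \<noteq> \<infinity>"
    using emeasure_poisson_weighted[OF assms] sets_eq_imp_space_eq[OF M_is_borel]
    by (simp add: poisson_weighted_def)
qed (simp add: poisson_weighted_def M_is_borel)

lemma measure_poisson_weighted:
  assumes "Im z \<noteq> 0"
  shows "measure (poisson_weighted z M) UNIV = (LINT x|M. 1 / (cmod (of_real x - z))\<^sup>2)"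
  using emeasure_poisson_weighted[OF assms] by (simp add: measure_def)

lemma Im_cauchy_transform:
  assumes "Im z \<noteq> 0"
  shows "Im (cauchy_transform M z) = Im z * measure (poisson_weighted z M) UNIV"
proof -
  have "Im (1 / (of_real x - z)) = Im z * (1 / (cmod (of_real x - z))\<^sup>2)" for x
    by (simp add: Im_divide cmod_power2)
  then have "(LINT x|M. Im (1 / (of_real x - z))) = Im z * (LINT x|M. 1 / (cmod (of_real x - z))\<^sup>2)"
    by (simp only: integral_mult_right_zero)
  then show ?thesis
    using integrable_resolvent[OF assms]
    by (simp add: cauchy_transform_def measure_poisson_weighted[OF assms])
qed

text \<open>
  With \<open>Q w = (w - Re z0)\<^sup>2 + (Im z0)\<^sup>2\<close>, so that \<open>Q x = \<bar>x - z0\<bar>\<^sup>2\<close> for real \<open>x\<close>, the difference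
  \<open>Q x - Q z\<close> is divisible by \<open>x - z\<close>. This gives the partial fraction expansion
  \<open>1 / ((x - z) Q x) = (1 / (x - z) - (x + z - 2 Re z0) / Q x) / Q z\<close>, and the last term is
  expressed through \<open>Re (1 / (x - z0)) = (x - Re z0) / Q x\<close> and \<open>Im (1 / (x - z0)) = Im z0 / Q x\<close>.
\<close>
lemma cauchy_transform_poisson_weighted:
  assumes z: "Im z > 0" and z0: "Im z0 > 0" and neq: "z \<noteq> z0"
  shows "cauchy_transform (poisson_weighted z0 M) z =
    1 / ((z - of_real (Re z0))\<^sup>2 + of_real ((Im z0)\<^sup>2)) *
      (cauchy_transform M z - of_real (Re (cauchy_transform M z0))
        - (z - of_real (Re z0)) / of_real (Im z0) * of_real (Im (cauchy_transform M z0)))"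
proof -
  define Q where "Q w = (w - of_real (Re z0))\<^sup>2 + of_real ((Im z0)\<^sup>2)" for w :: complex
  define R where "R x = 1 / (complex_of_real x - z0)" for x
  have Q_factor: "Q w = (w - z0) * (w - cnj z0)" for w
    by (simp add: Q_def complex_eq_iff power2_eq_square algebra_simps)
  have Qz: "Q z \<noteq> 0"
    using z z0 neq by (auto simp: Q_factor)
  have nz: "complex_of_real x - z \<noteq> 0" "complex_of_real x - z0 \<noteq> 0" "complex_of_real x - cnj z0 \<noteq> 0" for x
    using z z0 by (intro real_minus_nonreal_nonzero; simp)+
  have Qx: "of_real ((cmod (of_real x - z0))\<^sup>2) = Q (of_real x)" for x
    by (simp add: Q_factor complex_norm_square del: of_real_power)
  have Re_R: "complex_of_real (Re (R x)) = (of_real x - of_real (Re z0)) / Q (of_real x)" for x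
  proof -
    have "complex_of_real (Re (R x)) = of_real ((x - Re z0) / (cmod (of_real x - z0))\<^sup>2)"
      by (simp add: R_def Re_divide cmod_power2)
    then show ?thesis by (simp add: Qx[symmetric])
  qed
  have Im_R: "complex_of_real (Im (R x)) = of_real (Im z0) / Q (of_real x)" for x
  proof -
    have "complex_of_real (Im (R x)) = of_real (Im z0 / (cmod (of_real x - z0))\<^sup>2)"
      by (simp add: R_def Im_divide cmod_power2)
    then show ?thesis by (simp add: Qx[symmetric])
  qed
  have partial_fractions: "1 / (of_real x - z) / Q (of_real x) = 1 / Q z *
      (1 / (of_real x - z) - of_real (Re (R x))
        - (z - of_real (Re z0)) / of_real (Im z0) * of_real (Im (R x)))" for x
  proof -
    have Qx0: "Q (of_real x) \<noteq> 0"
      using nz[of x] by (simp add: Q_factor)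
    have diff: "Q (of_real x) - Q z = (of_real x - z) * (of_real x + z - 2 * of_real (Re z0))"
      by (simp add: Q_def power2_eq_square algebra_simps)
    have "1 / (of_real x - z) - of_real (Re (R x)) - (z - of_real (Re z0)) / of_real (Im z0) * of_real (Im (R x))
        = 1 / (of_real x - z) - (of_real x + z - 2 * of_real (Re z0)) / Q (of_real x)"
      using z0 by (simp add: Re_R Im_R diff_divide_distrib[symmetric] add_divide_distrib[symmetric] diff_diff_eq)
    also have "\<dots> = (Q (of_real x) - (of_real x - z) * (of_real x + z - 2 * of_real (Re z0)))
        / ((of_real x - z) * Q (of_real x))"
      using nz(1)[of x] Qx0 by (simp add: diff_frac_eq mult.commute)
    also have "\<dots> = Q z / ((of_real x - z) * Q (of_real x))"
      by (simp only: diff[symmetric]) simp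
    finally show ?thesis
      using Qz by simp
  qed
  have "continuous_on UNIV (\<lambda>x. 1 / (complex_of_real x - z))"
    by (intro continuous_intros ballI nz)
  then have "cauchy_transform (poisson_weighted z0 M) z = (LINT x|M. 1 / (of_real x - z) / Q (of_real x))"
    unfolding cauchy_transform_def using z0
    by (simp add: integral_poisson_weighted Qx del: of_real_power)
  also have "\<dots> = (LINT x|M. 1 / Q z *
      (1 / (of_real x - z) - of_real (Re (R x))
        - (z - of_real (Re z0)) / of_real (Im z0) * of_real (Im (R x))))"
    by (simp only: partial_fractions)
  also have "\<dots> = 1 / Q z * (LINT x|M.
      1 / (of_real x - z) - of_real (Re (R x))
        - (z - of_real (Re z0)) / of_real (Im z0) * of_real (Im (R x)))"
    by (rule integral_mult_right_zero)
  also have "(LINT x|M. 1 / (of_real x - z) - of_real (Re (R x))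
        - (z - of_real (Re z0)) / of_real (Im z0) * of_real (Im (R x))) =
      cauchy_transform M z - of_real (Re (cauchy_transform M z0))
        - (z - of_real (Re z0)) / of_real (Im z0) * of_real (Im (cauchy_transform M z0))"
  proof -
    have R: "integrable M R"
      unfolding R_def using z0 by (intro integrable_resolvent) simp
    have "cauchy_transform M z0 = integral\<^sup>L M R"
      by (simp add: cauchy_transform_def R_def[abs_def])
    moreover have "integrable M (\<lambda>x. 1 / (complex_of_real x - z))"
      using z by (intro integrable_resolvent) simp
    moreover have "integrable M (\<lambda>x. complex_of_real (Re (R x)))" "integrable M (\<lambda>x. complex_of_real (Im (R x)))"
      using R by (intro integrable_of_real integrable_Re integrable_Im; assumption)+
    ultimately show ?thesis
      using R by (simp add: cauchy_transform_def)
  qed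
  finally show ?thesis
    by (simp add: Q_def)
qed

text \<open>
  One factor \<open>x - cnj z\<close> cancels against \<open>\<bar>x - z\<bar>\<^sup>2 = (x - z) (x - cnj z)\<close>; the remaining ones are
  expanded through \<open>(x - cnj z) / (x - z) = 1 + (z - cnj z) / (x - z)\<close>. Only powers of \<open>1 / (x - z)\<close>
  are left, whose integrals are Taylor coefficients of the Cauchy transform at \<open>z\<close>.
\<close>
lemma circle_moment_poisson_weighted:
  assumes z: "Im z > 0"
  shows "(LINT x|poisson_weighted z M. ((of_real x - cnj z) / (of_real x - z)) ^ Suc k) =
    (\<Sum>j\<le>k. of_nat (k choose j) * (z - cnj z) ^ j * (LINT x|M. 1 / (of_real x - z) ^ Suc (Suc j)))"
proof -
  have nz: "complex_of_real x - z \<noteq> 0" "complex_of_real x - cnj z \<noteq> 0" for x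
    using z by (intro real_minus_nonreal_nonzero; simp)+
  have Qx: "of_real ((cmod (of_real x - z))\<^sup>2) = (of_real x - z) * (of_real x - cnj z)" for x
    by (simp add: complex_norm_square del: of_real_power)
  have expand: "((of_real x - cnj z) / (of_real x - z)) ^ Suc k / of_real ((cmod (of_real x - z))\<^sup>2) =
      (\<Sum>j\<le>k. of_nat (k choose j) * (z - cnj z) ^ j * (1 / (of_real x - z) ^ Suc (Suc j)))" for x
  proof -
    let ?d = "complex_of_real x - z"
    have v: "(of_real x - cnj z) / ?d = (z - cnj z) / ?d + 1"
      using nz[of x] by (simp add: field_simps)
    have "((of_real x - cnj z) / ?d) ^ Suc k / of_real ((cmod (of_real x - z))\<^sup>2) =
        ((of_real x - cnj z) / ?d) ^ k * (1 / ?d\<^sup>2)"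
    proof -
      have "a / d * p / (d * a) = p * (1 / d\<^sup>2)" if "a \<noteq> 0" for a d p :: complex
        using that by (simp add: power2_eq_square divide_simps)
      from this[OF nz(2)[of x]] show ?thesis
        by (simp only: Qx power_Suc)
    qed
    also have "\<dots> = (\<Sum>j\<le>k. of_nat (k choose j) * ((z - cnj z) / ?d) ^ j) * (1 / ?d\<^sup>2)"
      unfolding v by (subst binomial_ring) simp
    also have "\<dots> = (\<Sum>j\<le>k. of_nat (k choose j) * (z - cnj z) ^ j * (1 / ?d ^ Suc (Suc j)))"
      unfolding sum_distrib_right by (intro sum.cong) (auto simp: power_divide power2_eq_square mult_ac)
    finally show ?thesis .
  qed
  have "continuous_on UNIV (\<lambda>x. ((of_real x - cnj z) / (of_real x - z)) ^ Suc k)"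
    by (intro continuous_intros ballI nz)
  then have "(LINT x|poisson_weighted z M. ((of_real x - cnj z) / (of_real x - z)) ^ Suc k) =
      (LINT x|M. ((of_real x - cnj z) / (of_real x - z)) ^ Suc k / of_real ((cmod (of_real x - z))\<^sup>2))"
    using z by (intro integral_poisson_weighted) auto
  also have "\<dots> = (LINT x|M. (\<Sum>j\<le>k. of_nat (k choose j) * (z - cnj z) ^ j * (1 / (of_real x - z) ^ Suc (Suc j))))"
    by (simp only: expand)
  also have "\<dots> = (\<Sum>j\<le>k. LINT x|M. of_nat (k choose j) * (z - cnj z) ^ j * (1 / (of_real x - z) ^ Suc (Suc j)))"
    using z by (intro Bochner_Integration.integral_sum integrable_mult_right integrable_resolvent_power) auto
  also have "\<dots> = (\<Sum>j\<le>k. of_nat (k choose j) * (z - cnj z) ^ j * (LINT x|M. 1 / (of_real x - z) ^ Suc (Suc j)))"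
    by (intro sum.cong integral_mult_right_zero) auto
  finally show ?thesis .
qed

text \<open>
  A Harnack-type inequality: the transform at one point \<open>w\<close> controls it everywhere. From
  \<open>1 / (x - z) - 1 / (x - w) = (z - w) / ((x - z) (x - w))\<close> and
  \<open>\<bar>x - w\<bar> \<le> (1 + \<bar>z - w\<bar> / Im z) \<bar>x - z\<bar>\<close>, the difference of the two transforms is bounded by a multiple
  of the integral of \<open>1 / \<bar>x - w\<bar>\<^sup>2\<close>, which is \<open>Im (cauchy_transform M w) / Im w\<close>.
\<close>
lemma cauchy_transform_bound:
  assumes z: "Im z > 0" and w: "Im w > 0"
  shows "cmod (cauchy_transform M z) \<le>
    cmod (cauchy_transform M w) * (1 + cmod (z - w) * (1 + cmod (z - w) / Im z) / Im w)"
proof -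
  let ?c = "cmod (z - w)"
  have nz: "complex_of_real x - z \<noteq> 0" "complex_of_real x - w \<noteq> 0" for x
    using z w by (intro real_minus_nonreal_nonzero; simp)+
  have pointwise: "cmod (1 / (of_real x - z) - 1 / (of_real x - w)) \<le>
      ?c * (1 + ?c / Im z) * (1 / (cmod (of_real x - w))\<^sup>2)" for x
  proof -
    let ?a = "cmod (of_real x - z)" and ?b = "cmod (of_real x - w)"
    have a: "?a > 0" "?a \<ge> Im z" and b: "?b > 0"
      using nz abs_Im_le_cmod_diff[of z x] z by auto
    have "?b \<le> ?a + ?c"
      using norm_triangle_ineq[of "of_real x - z" "z - w"] by simp
    also have "\<dots> \<le> ?a + ?c * (?a / Im z)"
    proof -
      have "?c * 1 \<le> ?c * (?a / Im z)"
        using a z by (intro mult_left_mono) auto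
      then show ?thesis by simp
    qed
    also have "\<dots> = (1 + ?c / Im z) * ?a"
      using z by (simp add: field_simps)
    finally have ab: "?b \<le> (1 + ?c / Im z) * ?a" .
    have "1 / (of_real x - z) - 1 / (of_real x - w) = (z - w) / ((of_real x - z) * (of_real x - w))"
      using nz[of x] by (simp add: field_simps)
    then have "cmod (1 / (of_real x - z) - 1 / (of_real x - w)) = ?c * (1 / (?a * ?b))"
      by (simp add: norm_divide norm_mult)
    also have "1 / (?a * ?b) \<le> (1 + ?c / Im z) * (1 / ?b\<^sup>2)"
      using ab a b by (simp add: divide_simps power2_eq_square mult_ac)
    finally show ?thesis
      by (simp add: mult_left_mono mult.assoc)
  qed
  have int: "integrable M (\<lambda>x. 1 / (complex_of_real x - z))" "integrable M (\<lambda>x. 1 / (complex_of_real x - w))"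
    using z w by (intro integrable_resolvent; simp)+
  have "cmod (cauchy_transform M z - cauchy_transform M w) =
      cmod (LINT x|M. 1 / (of_real x - z) - 1 / (of_real x - w))"
    unfolding cauchy_transform_def using int by simp
  also have "\<dots> \<le> (LINT x|M. cmod (1 / (of_real x - z) - 1 / (of_real x - w)))"
    by (rule integral_norm_bound)
  also have "\<dots> \<le> (LINT x|M. ?c * (1 + ?c / Im z) * (1 / (cmod (of_real x - w))\<^sup>2))"
    using int w pointwise
    by (intro integral_mono integrable_norm Bochner_Integration.integrable_diff integrable_mult_right
      integrable_poisson_weight) auto
  also have "\<dots> = ?c * (1 + ?c / Im z) * (LINT x|M. 1 / (cmod (of_real x - w))\<^sup>2)"
    by (rule integral_mult_right_zero)
  also have "\<dots> = ?c * (1 + ?c / Im z) * (Im (cauchy_transform M w) / Im w)"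
    using w by (simp add: Im_cauchy_transform measure_poisson_weighted)
  also have "\<dots> \<le> ?c * (1 + ?c / Im z) * (cmod (cauchy_transform M w) / Im w)"
    using w z abs_Im_le_cmod[of "cauchy_transform M w"]
    by (intro mult_left_mono divide_right_mono) auto
  finally have "cmod (cauchy_transform M z - cauchy_transform M w) \<le>
      cmod (cauchy_transform M w) * (?c * (1 + ?c / Im z) / Im w)"
    by (simp add: mult_ac)
  with norm_triangle_ineq2[of "cauchy_transform M z" "cauchy_transform M w"] show ?thesis
    by (simp add: distrib_left)
qed

end

section \<open>Continuous functions on the line as functions on the circle\<close>

lemma tendsto_continuous_vanishing_at_infinity:
  "f \<in> continuous_vanishing \<Longrightarrow> (f \<longlongrightarrow> 0) at_infinity"
  by (auto simp: continuous_vanishing_def at_infinity_eq_at_top_bot filterlim_sup)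

text \<open>
  The Cayley map sends the line onto the circle without the point \<open>1\<close>, which stands for infinity.
  Its inverse \<open>c\<close> is real on the circle and tends to infinity at \<open>1\<close>, so \<open>f \<circ> c\<close> extends
  continuously by zero.
\<close>
lemma continuous_on_circle_of_continuous_vanishing:
  fixes f :: "real \<Rightarrow> complex"
  assumes f: "f \<in> continuous_vanishing" and z: "Im z > 0"
  obtains h where "continuous_on (sphere 0 1) h"
    and "\<And>x. h ((of_real x - cnj z) / (of_real x - z)) = f x"
proof -
  define c where "c u = (u * z - cnj z) / (u - 1)" for u :: complex
  define h where "h u = (if u = 1 then 0 else f (Re (c u)))" for u
  have z_neq: "z - cnj z \<noteq> 0"
    using z by (auto simp: complex_eq_iff)
  have nz: "complex_of_real x - z \<noteq> 0" for x
    using z by (intro real_minus_nonreal_nonzero) simp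
  have h_eq: "h ((of_real x - cnj z) / (of_real x - z)) = f x" for x
  proof -
    let ?u = "(of_real x - cnj z) / (of_real x - z)"
    have u1: "?u - 1 = (z - cnj z) / (of_real x - z)"
      using nz[of x] by (simp add: divide_simps)
    have "?u * z - cnj z = of_real x * (z - cnj z) / (of_real x - z)"
      using nz[of x] by (simp add: divide_simps) (simp add: algebra_simps)
    then have "c ?u = of_real x"
      unfolding c_def u1 using z_neq nz[of x] by simp
    moreover have "?u \<noteq> 1"
      using u1 z_neq nz[of x] by auto
    ultimately show ?thesis
      unfolding h_def by (simp only: if_False Re_complex_of_real)
  qed
  have real_c: "c u = of_real (Re (c u))" if "u \<noteq> 1" "cmod u = 1" for u
  proof -
    have cnj_u: "cnj u = 1 / u" "u \<noteq> 0"
      using that by (auto simp: divide_conv_cnj)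
    have "cnj (c u) = c u"
      unfolding c_def using that(1) cnj_u(2)
      by (simp add: cnj_u(1) divide_simps) (simp add: algebra_simps)
    then show ?thesis
      by (simp add: complex_eq_iff)
  qed
  have "continuous (at u within sphere 0 1) h" if u: "u \<in> sphere 0 1" for u
  proof (cases "u = 1")
    case False
    have "isCont f (Re (c u))"
      using f by (auto simp: continuous_vanishing_def continuous_on_eq_continuous_at)
    moreover have "isCont (\<lambda>u. Re (c u)) u"
      unfolding c_def using False by (intro isCont_Re isCont_divide continuous_intros) auto
    ultimately have "isCont (\<lambda>u. f (Re (c u))) u"
      by (rule isCont_o2[rotated])
    moreover have "\<forall>\<^sub>F w in nhds u. w \<in> - {1}"
      using False by (intro eventually_nhds_in_open) auto
    then have "\<forall>\<^sub>F w in nhds u. h w = f (Re (c w))"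
      by eventually_elim (simp add: h_def)
    ultimately have "isCont h u"
      by (simp add: isCont_cong)
    then show ?thesis
      by (rule continuous_at_imp_continuous_at_within)
  next
    case True
    let ?F = "at 1 within sphere 0 (1::real) :: complex filter"
    have "((\<lambda>u. u * z - cnj z) \<longlongrightarrow> z - cnj z) ?F" "((\<lambda>u. u - 1) \<longlongrightarrow> 0) ?F"
      by (auto intro!: tendsto_eq_intros)
    moreover have "\<forall>\<^sub>F u in ?F. u - 1 \<noteq> 0"
      by (auto simp: eventually_at_filter)
    ultimately have "filterlim c at_infinity ?F"
      unfolding c_def using z_neq by (intro filterlim_divide_at_infinity) (auto simp: filterlim_at)
    then have "filterlim (\<lambda>u. norm (c u)) at_top ?F"
      by (simp add: filterlim_at_infinity_conv_norm_at_top)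
    moreover have "\<forall>\<^sub>F u in ?F. norm (c u) = norm (Re (c u))"
      unfolding eventually_at_filter
      by (intro always_eventually allI impI) (metis mem_sphere_0 norm_of_real real_c real_norm_def)
    ultimately have "filterlim (\<lambda>u. norm (Re (c u))) at_top ?F"
      using filterlim_cong by fastforce
    then have "filterlim (\<lambda>u. Re (c u)) at_infinity ?F"
      by (simp add: filterlim_at_infinity_conv_norm_at_top)
    from filterlim_compose[OF tendsto_continuous_vanishing_at_infinity[OF f] this]
    have "((\<lambda>u. f (Re (c u))) \<longlongrightarrow> 0) ?F" .
    moreover have "\<forall>\<^sub>F u in ?F. f (Re (c u)) = h u"
      by (auto simp: h_def eventually_at_filter)
    ultimately have "(h \<longlongrightarrow> 0) ?F"
      by (rule Lim_transform_eventually)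
    then show ?thesis
      unfolding True by (simp add: continuous_within h_def)
  qed
  then have "continuous_on (sphere 0 1) h"
    by (simp add: continuous_on_eq_continuous_within)
  with h_eq show ?thesis
    by (rule that[rotated])
qed

section \<open>Sequences of Cauchy transforms\<close>

lemma connected_upper_half_plane: "connected upper_half_plane"
  unfolding upper_half_plane_def by (rule convex_connected[OF convex_halfspace_Im_gt])

lemma cauchy_transforms_locally_bounded:
  assumes fin: "\<And>n. finite_borel_measure (\<omega> n)"
    and w: "w \<in> upper_half_plane" and conv: "convergent (\<lambda>n. cauchy_transform (\<omega> n) w)"
    and K: "compact K" "K \<subseteq> upper_half_plane"
  shows "\<exists>B. \<forall>n. \<forall>z\<in>K. cmod (cauchy_transform (\<omega> n) z) \<le> B"
proof -
  define G where "G z = 1 + cmod (z - w) * (1 + cmod (z - w) / Im z) / Im w" for z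
  have w': "Im w > 0"
    using w by (simp add: upper_half_plane_def)
  have K_pos: "Im z > 0" if "z \<in> K" for z
    using that K(2) by (auto simp: upper_half_plane_def)
  obtain A where A: "\<And>n. cmod (cauchy_transform (\<omega> n) w) \<le> A"
    using convergent_imp_Bseq[OF conv] by (auto simp: Bseq_def)
  have "continuous_on K G"
    unfolding G_def using K_pos w' by (intro continuous_intros) (auto dest: K_pos)
  then have "bounded (G ` K)"
    by (intro compact_imp_bounded compact_continuous_image K)
  then obtain C where C: "\<And>z. z \<in> K \<Longrightarrow> \<bar>G z\<bar> \<le> C"
    unfolding bounded_iff by fastforce
  have "cmod (cauchy_transform (\<omega> n) z) \<le> A * C" if z: "z \<in> K" for n z
  proof -
    have G0: "0 \<le> G z"
      using K_pos[OF z] w' by (simp add: G_def)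
    have "cmod (cauchy_transform (\<omega> n) z) \<le> cmod (cauchy_transform (\<omega> n) w) * G z"
      unfolding G_def by (rule finite_borel_measure.cauchy_transform_bound[OF fin K_pos[OF z] w'])
    also have "\<dots> \<le> A * C"
      using A[of n] C[OF z] G0 by (intro mult_mono) (auto intro: order_trans[OF norm_ge_zero])
    finally show ?thesis .
  qed
  then show ?thesis by blast
qed

text \<open>
  Masses and moments of the weighted measures are determined by the Taylor coefficients of the transforms at
  \<open>z0\<close>, so they converge and make all integrals of continuous functions vanishing at infinity converge.
  The measure comes from a subsequence; its integrals are forced to be the limits along the full sequence.
\<close>
lemma poisson_weighted_vague_limit:
  fixes \<omega> :: "nat \<Rightarrow> real measure"
  assumes fin: "\<And>n. finite_borel_measure (\<omega> n)"
    and g: "\<And>K. compact K \<Longrightarrow> K \<subseteq> upper_half_plane \<Longrightarrow>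
      uniform_limit K (\<lambda>n. cauchy_transform (\<omega> n)) g sequentially"
    and z0: "z0 \<in> upper_half_plane"
  shows "(\<lambda>n. measure (poisson_weighted z0 (\<omega> n)) UNIV) \<longlonglongrightarrow> Im (g z0) / Im z0" (is "?mass")
    and "\<exists>\<tau>. finite_borel_measure \<tau> \<and> measure \<tau> UNIV \<le> Im (g z0) / Im z0 \<and>
      (\<forall>f :: real \<Rightarrow> complex. f \<in> continuous_vanishing \<longrightarrow>
        (\<lambda>n. integral\<^sup>L (poisson_weighted z0 (\<omega> n)) f) \<longlonglongrightarrow> integral\<^sup>L \<tau> f)"
proof -
  have y0: "Im z0 > 0"
    using z0 by (simp add: upper_half_plane_def)
  define \<mu> where "\<mu> n = poisson_weighted z0 (\<omega> n)" for n
  have \<mu>: "finite_borel_measure (\<mu> n)" for n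
    unfolding \<mu>_def using y0 by (intro finite_borel_measure.finite_borel_measure_poisson_weighted[OF fin]) simp
  have sets_\<mu>: "sets (\<mu> n) = sets borel" for n
    by (rule finite_borel_measure.M_is_borel[OF \<mu>])
  have "(\<lambda>n. cauchy_transform (\<omega> n) z0) \<longlonglongrightarrow> g z0"
    using g[of "{z0}"] z0 by (simp add: uniform_limit_singleton)
  then have "(\<lambda>n. Im (cauchy_transform (\<omega> n) z0) / Im z0) \<longlonglongrightarrow> Im (g z0) / Im z0"
    using y0 by (intro tendsto_intros) auto
  then show mass: ?mass
    using y0 by (simp add: finite_borel_measure.Im_cauchy_transform[OF fin])
  obtain e where e: "e > 0" "cball z0 e \<subseteq> upper_half_plane"
    using open_contains_cball open_upper_half_plane z0 by blast
  have resolvent_powers: "convergent (\<lambda>n. LINT x|\<omega> n. 1 / (of_real x - z0) ^ Suc j)" for j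
  proof -
    have "uniform_limit (ball z0 e) (\<lambda>n. cauchy_transform (\<omega> n)) g sequentially"
      using g[OF compact_cball e(2)] by (rule uniform_limit_on_subset) auto
    moreover have "cauchy_transform (\<omega> n) holomorphic_on ball z0 e" for n
      using finite_borel_measure.cauchy_transform_holomorphic[OF fin]
      by (rule holomorphic_on_subset) (use e(2) in auto)
    ultimately have "(\<lambda>n. (deriv ^^ j) (cauchy_transform (\<omega> n)) z0) \<longlonglongrightarrow> (deriv ^^ j) g z0"
      using e(1) by (intro higher_deriv_complex_uniform_limit[where A = "ball z0 e"]) auto
    then have "(\<lambda>n. fact j * (LINT x|\<omega> n. 1 / (of_real x - z0) ^ Suc j)) \<longlonglongrightarrow> (deriv ^^ j) g z0"
      using y0 by (simp only: finite_borel_measure.higher_deriv_cauchy_transform[OF fin])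
    from tendsto_divide[OF this tendsto_const, of "fact j"] show ?thesis
      by (auto simp: convergent_def)
  qed
  \<comment> \<open>The pole is at \<open>z0\<close> so that powers of \<open>v\<close> expand in the Taylor coefficients of the transforms at \<open>z0\<close>.\<close>
  define v where "v x = (complex_of_real x - cnj z0) / (of_real x - z0)" for x
  have nz: "complex_of_real x - z0 \<noteq> 0" for x
    using y0 by (intro real_minus_nonreal_nonzero) simp
  have unit: "cmod (v x) = 1" for x
  proof -
    have "cmod (of_real x - cnj z0) = cmod (cnj (of_real x - z0))"
      by simp
    then show ?thesis
      using nz[of x] by (simp add: v_def norm_divide del: complex_cnj_diff)
  qed
  have v_meas: "v \<in> borel_measurable (\<mu> n)" for n
  proof -
    have "continuous_on UNIV v"
      unfolding v_def by (intro continuous_intros ballI nz)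
    from borel_measurable_continuous_onI[OF this] show ?thesis
      using sets_\<mu> by (simp cong: measurable_cong_sets)
  qed
  have moments: "convergent (\<lambda>n. LINT x|\<mu> n. v x ^ k)" for k
  proof (cases k)
    case 0
    have "(LINT x|\<mu> n. v x ^ 0) = complex_of_real (measure (\<mu> n) UNIV)" for n
      using sets_eq_imp_space_eq[OF sets_\<mu>[of n]] by (simp add: scaleR_conv_of_real)
    with 0 tendsto_of_real[OF mass, where 'a = complex] show ?thesis
      by (auto simp: convergent_def \<mu>_def)
  next
    case (Suc l)
    have "convergent (\<lambda>n. \<Sum>j\<le>l. of_nat (l choose j) * (z0 - cnj z0) ^ j *
        (LINT x|\<omega> n. 1 / (of_real x - z0) ^ Suc (Suc j)))"
      by (intro convergent_sum convergent_mult convergent_const resolvent_powers)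
    then show ?thesis
      unfolding Suc \<mu>_def v_def
      by (simp only: finite_borel_measure.circle_moment_poisson_weighted[OF fin y0])
  qed
  have conv: "convergent (\<lambda>n. integral\<^sup>L (\<mu> n) f)" if f: "f \<in> continuous_vanishing"
    for f :: "real \<Rightarrow> complex"
  proof -
    obtain h where h: "continuous_on (sphere 0 1) h" and h_v: "\<And>x. h (v x) = f x"
      using continuous_on_circle_of_continuous_vanishing[OF f y0] unfolding v_def by blast
    have "convergent (\<lambda>n. LINT x|\<mu> n. h (v x))"
      using finite_borel_measure.axioms(1)[OF \<mu>] v_meas unit moments h
      by (rule convergent_integral_circle)
    then show ?thesis
      by (simp only: h_v)
  qed
  obtain r \<tau> where r: "strict_mono (r :: nat \<Rightarrow> nat)" and \<tau>: "finite_borel_measure \<tau>"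
      "measure \<tau> UNIV \<le> Im (g z0) / Im z0"
    and sub: "\<And>f :: real \<Rightarrow> complex. f \<in> continuous_vanishing \<Longrightarrow>
      (\<lambda>n. integral\<^sup>L (\<mu> (r n)) f) \<longlonglongrightarrow> integral\<^sup>L \<tau> f"
    using vague_sequential_compactness[OF \<mu> mass[folded \<mu>_def]] by blast
  have "(\<lambda>n. integral\<^sup>L (\<mu> n) f) \<longlonglongrightarrow> integral\<^sup>L \<tau> f" if f: "f \<in> continuous_vanishing"
    for f :: "real \<Rightarrow> complex"
  proof -
    obtain l where l: "(\<lambda>n. integral\<^sup>L (\<mu> n) f) \<longlonglongrightarrow> l"
      using conv[OF f] by (auto simp: convergent_def)
    have "l = integral\<^sup>L \<tau> f"
      using LIMSEQ_subseq_LIMSEQ[OF l r] sub[OF f] by (intro LIMSEQ_unique) (auto simp: o_def)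
    with l show ?thesis by simp
  qed
  with \<tau> show "\<exists>\<tau>. finite_borel_measure \<tau> \<and> measure \<tau> UNIV \<le> Im (g z0) / Im z0 \<and>
      (\<forall>f :: real \<Rightarrow> complex. f \<in> continuous_vanishing \<longrightarrow>
        (\<lambda>n. integral\<^sup>L (poisson_weighted z0 (\<omega> n)) f) \<longlonglongrightarrow> integral\<^sup>L \<tau> f)"
    unfolding \<mu>_def by blast
qed

lemma resolvent_in_continuous_vanishing:
  assumes "Im z \<noteq> 0"
  shows "(\<lambda>x. 1 / (complex_of_real x - z)) \<in> continuous_vanishing"
proof -
  have "((\<lambda>x. 1 / (complex_of_real x - z)) \<longlongrightarrow> 0) F" if F: "filterlim (\<lambda>x. x) at_infinity F" for F :: "real filter"
  proof -
    have "filterlim (\<lambda>x. complex_of_real x) at_infinity F"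
      using F by (simp add: filterlim_at_infinity_conv_norm_at_top)
    then have "filterlim (\<lambda>x. complex_of_real x + (- z)) at_infinity F"
      by (rule tendsto_add_filterlim_at_infinity'[OF _ tendsto_const])
    from tendsto_inverse_0[THEN filterlim_compose, OF this] show ?thesis
      by (simp add: inverse_eq_divide)
  qed
  moreover have "continuous_on UNIV (\<lambda>x. 1 / (complex_of_real x - z))"
    by (intro continuous_intros ballI real_minus_nonreal_nonzero assms)
  ultimately show ?thesis
    using at_top_le_at_infinity at_bot_le_at_infinity
    by (auto simp: continuous_vanishing_def filterlim_def)
qed

theorem lemma4p1:
  fixes \<omega> :: "nat \<Rightarrow> real measure" and X :: "complex set"
  assumes "\<And>n. finite_borel_measure (\<omega> n)"
    and "X \<subseteq> upper_half_plane"
    and "\<exists>p\<in>upper_half_plane. p islimpt X"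
    and "\<And>z. z \<in> X \<Longrightarrow> convergent (\<lambda>n. cauchy_transform (\<omega> n) z)"
  shows "\<exists>g :: complex \<Rightarrow> complex.
    g holomorphic_on upper_half_plane \<and>
    g ` upper_half_plane \<subseteq> upper_half_plane \<union> \<real> \<and>
    locally_uniform_limit upper_half_plane (\<lambda>n. cauchy_transform (\<omega> n)) g sequentially \<and>
    (\<forall>(x0::real) (y0::real) z0. y0 > 0 \<and> z0 = Complex x0 y0 \<longrightarrow>
      (\<exists>\<tau> :: real measure.
        finite_borel_measure \<tau> \<and>
        (\<forall>f :: real \<Rightarrow> complex. f \<in> continuous_vanishing \<longrightarrow>
          (\<lambda>n. LINT x|\<omega> n. f x / of_real ((cmod (of_real x - z0))\<^sup>2))
            \<longlonglongrightarrow> (LINT x|\<tau>. f x)) \<and>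
        emeasure \<tau> UNIV \<le> ennreal (Im (g z0) / y0) \<and>
        (\<forall>z \<in> upper_half_plane - {z0}.
          cauchy_transform \<tau> z =
            1 / ((z - of_real x0)\<^sup>2 + of_real (y0\<^sup>2)) *
              (g z - of_real (Re (g z0)) - (z - of_real x0) / of_real y0 * of_real (Im (g z0)))) \<and>
        (emeasure \<tau> UNIV = ennreal (Im (g z0) / y0) \<longrightarrow>
          (\<forall>f :: real \<Rightarrow> complex. f \<in> continuous_bounded \<longrightarrow>
            (\<lambda>n. LINT x|\<omega> n. f x / of_real ((cmod (of_real x - z0))\<^sup>2))
              \<longlonglongrightarrow> (LINT x|\<tau>. f x)))))"
proof -
  note fin = assms(1)
  obtain p where p: "p \<in> upper_half_plane" "p islimpt X"
    using assms(3) by blast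
  then obtain w where w: "w \<in> X"
    by (metis all_not_in_conv islimpt_EMPTY)
  have bounded: "\<exists>B. \<forall>n. \<forall>z\<in>K. cmod (cauchy_transform (\<omega> n) z) \<le> B"
    if "compact K" "K \<subseteq> upper_half_plane" for K
    using w assms(2) that by (intro cauchy_transforms_locally_bounded[OF fin _ assms(4)[OF w]]) auto
  obtain g where g: "g holomorphic_on upper_half_plane"
    and unif: "\<And>K. compact K \<Longrightarrow> K \<subseteq> upper_half_plane \<Longrightarrow>
      uniform_limit K (\<lambda>n. cauchy_transform (\<omega> n)) g sequentially"
    using Vitali_convergence[OF open_upper_half_plane connected_upper_half_plane
        finite_borel_measure.cauchy_transform_holomorphic[OF fin] bounded assms(2) p assms(4)]
    by blast
  have lim: "(\<lambda>n. cauchy_transform (\<omega> n) z) \<longlonglongrightarrow> g z" if "z \<in> upper_half_plane" for z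
    using unif[of "{z}"] that by (simp add: uniform_limit_singleton)
  have Im_g: "Im (g z) \<ge> 0" if z: "z \<in> upper_half_plane" for z
  proof (rule LIMSEQ_le_const[OF tendsto_Im[OF lim[OF z]]])
    have "Im (cauchy_transform (\<omega> n) z) \<ge> 0" for n
      using z by (simp add: upper_half_plane_def finite_borel_measure.Im_cauchy_transform[OF fin])
    then show "\<exists>N. \<forall>n\<ge>N. 0 \<le> Im (cauchy_transform (\<omega> n) z)"
      by blast
  qed
  have range_g: "g ` upper_half_plane \<subseteq> upper_half_plane \<union> \<real>"
    using Im_g by (force simp: upper_half_plane_def complex_is_Real_iff)
  have locally_uniform: "locally_uniform_limit upper_half_plane (\<lambda>n. cauchy_transform (\<omega> n)) g sequentially"
    unfolding locally_uniform_limit_def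
  proof
    fix z assume "z \<in> upper_half_plane"
    then obtain e where e: "e > 0" "cball z e \<subseteq> upper_half_plane"
      using open_contains_cball open_upper_half_plane by blast
    have "uniform_limit (upper_half_plane \<inter> ball z e) (\<lambda>n. cauchy_transform (\<omega> n)) g sequentially"
      using unif[OF compact_cball e(2)] by (rule uniform_limit_on_subset) auto
    with e(1) show "\<exists>U. open U \<and> z \<in> U \<and>
        uniform_limit (upper_half_plane \<inter> U) (\<lambda>n. cauchy_transform (\<omega> n)) g sequentially"
      by (intro exI[of _ "ball z e"]) auto
  qed
  have measure_at: "\<exists>\<tau> :: real measure.
        finite_borel_measure \<tau> \<and>
        (\<forall>f :: real \<Rightarrow> complex. f \<in> continuous_vanishing \<longrightarrow>
          (\<lambda>n. LINT x|\<omega> n. f x / of_real ((cmod (of_real x - z0))\<^sup>2))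
            \<longlonglongrightarrow> (LINT x|\<tau>. f x)) \<and>
        emeasure \<tau> UNIV \<le> ennreal (Im (g z0) / y0) \<and>
        (\<forall>z \<in> upper_half_plane - {z0}.
          cauchy_transform \<tau> z =
            1 / ((z - of_real x0)\<^sup>2 + of_real (y0\<^sup>2)) *
              (g z - of_real (Re (g z0)) - (z - of_real x0) / of_real y0 * of_real (Im (g z0)))) \<and>
        (emeasure \<tau> UNIV = ennreal (Im (g z0) / y0) \<longrightarrow>
          (\<forall>f :: real \<Rightarrow> complex. f \<in> continuous_bounded \<longrightarrow>
            (\<lambda>n. LINT x|\<omega> n. f x / of_real ((cmod (of_real x - z0))\<^sup>2))
              \<longlonglongrightarrow> (LINT x|\<tau>. f x)))"
    if y0: "y0 > 0" and z0: "z0 = Complex x0 y0" for x0 y0 :: real and z0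
  proof -
    have z0_pos: "Im z0 > 0" "Im z0 \<noteq> 0" and z0_in: "z0 \<in> upper_half_plane"
      and coords: "Re z0 = x0" "Im z0 = y0"
      using y0 z0 by (auto simp: upper_half_plane_def)
    note mass = poisson_weighted_vague_limit(1)[OF fin unif z0_in, unfolded coords]
    have "\<exists>\<tau>. finite_borel_measure \<tau> \<and> measure \<tau> UNIV \<le> Im (g z0) / y0 \<and>
      (\<forall>f :: real \<Rightarrow> complex. f \<in> continuous_vanishing \<longrightarrow>
        (\<lambda>n. integral\<^sup>L (poisson_weighted z0 (\<omega> n)) f) \<longlonglongrightarrow> integral\<^sup>L \<tau> f)"
      using poisson_weighted_vague_limit(2)[OF fin unif z0_in, unfolded coords] .
    then obtain \<tau> where \<tau>: "finite_borel_measure \<tau>" "measure \<tau> UNIV \<le> Im (g z0) / y0"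
      and vague: "\<And>f :: real \<Rightarrow> complex. f \<in> continuous_vanishing \<Longrightarrow>
        (\<lambda>n. integral\<^sup>L (poisson_weighted z0 (\<omega> n)) f) \<longlonglongrightarrow> integral\<^sup>L \<tau> f"
      by blast
    interpret \<tau>: finite_borel_measure \<tau> by (rule \<tau>)
    have weighted: "finite_borel_measure (poisson_weighted z0 (\<omega> n))" for n
      by (rule finite_borel_measure.finite_borel_measure_poisson_weighted[OF fin z0_pos(2)])
    have integral_weighted: "(LINT x|\<omega> n. f x / of_real ((cmod (of_real x - z0))\<^sup>2)) =
        integral\<^sup>L (poisson_weighted z0 (\<omega> n)) f" if "continuous_on UNIV f" for f :: "real \<Rightarrow> complex" and n
      by (rule finite_borel_measure.integral_poisson_weighted[OF fin z0_pos(2) that, symmetric])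
    show ?thesis
    proof (intro exI[of _ \<tau>] conjI allI ballI impI)
      show "finite_borel_measure \<tau>"
        by (rule \<tau>)
      show "emeasure \<tau> UNIV \<le> ennreal (Im (g z0) / y0)"
        using \<tau>(2) by (simp add: \<tau>.emeasure_eq_measure ennreal_leI)
      show "(\<lambda>n. LINT x|\<omega> n. f x / of_real ((cmod (of_real x - z0))\<^sup>2)) \<longlonglongrightarrow> integral\<^sup>L \<tau> f"
        if f: "f \<in> continuous_vanishing" for f :: "real \<Rightarrow> complex"
        using vague[OF f] f by (subst integral_weighted) (auto simp: continuous_vanishing_def)
      show "cauchy_transform \<tau> z =
            1 / ((z - of_real x0)\<^sup>2 + of_real (y0\<^sup>2)) *
              (g z - of_real (Re (g z0)) - (z - of_real x0) / of_real y0 * of_real (Im (g z0)))"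
        if z: "z \<in> upper_half_plane - {z0}" for z
      proof (rule LIMSEQ_unique)
        have z': "Im z > 0" "Im z \<noteq> 0" "z \<noteq> z0" "z \<in> upper_half_plane"
          using z by (auto simp: upper_half_plane_def)
        show "(\<lambda>n. cauchy_transform (poisson_weighted z0 (\<omega> n)) z) \<longlonglongrightarrow> cauchy_transform \<tau> z"
          unfolding cauchy_transform_def by (rule vague[OF resolvent_in_continuous_vanishing[OF z'(2)]])
        show "(\<lambda>n. cauchy_transform (poisson_weighted z0 (\<omega> n)) z) \<longlonglongrightarrow>
            1 / ((z - of_real x0)\<^sup>2 + of_real (y0\<^sup>2)) *
              (g z - of_real (Re (g z0)) - (z - of_real x0) / of_real y0 * of_real (Im (g z0)))"
          unfolding finite_borel_measure.cauchy_transform_poisson_weighted[OF fin z'(1) z0_pos(1) z'(3)] coords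
          by (intro tendsto_mult tendsto_diff tendsto_const tendsto_of_real tendsto_Re tendsto_Im lim z'(4) z0_in)
      qed
      show "(\<lambda>n. LINT x|\<omega> n. f x / of_real ((cmod (of_real x - z0))\<^sup>2)) \<longlonglongrightarrow> integral\<^sup>L \<tau> f"
        if full: "emeasure \<tau> UNIV = ennreal (Im (g z0) / y0)" and f: "f \<in> continuous_bounded" for f :: "real \<Rightarrow> complex"
      proof -
        have "measure \<tau> UNIV = Im (g z0) / y0"
          using full Im_g[OF z0_in] y0 by (simp add: measure_def)
        then have "(\<lambda>n. integral\<^sup>L (poisson_weighted z0 (\<omega> n)) f) \<longlonglongrightarrow> integral\<^sup>L \<tau> f"
          using mass by (intro vague_limit_without_mass_loss[OF weighted \<tau>(1) vague _ f]) auto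
        then show ?thesis
          using f by (subst integral_weighted) (auto simp: continuous_bounded_def)
      qed
    qed
  qed
  show ?thesis
    by (intro exI[of _ g] conjI allI impI g range_g locally_uniform measure_at) auto
qed

end
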